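(* Let $X \subseteq \mathbb{C}$ be a continuum such that $\pi_0(\mathbb{C} \setminus X)$ is finite. Then the following assertions are equivalent. (i) $X$ is locally connected. (ii) For each $x \in X$, the pseudo-fiber $E_x$ of $x$ is trivial. (iii) For each $x \in X$, the fiber $F_x$ of $x$ is trivial.
   Context: A continuum is a compact connected set. $\hat{\mathbb{C}}=\mathbb{C}\cup\{\infty\}$ is the extended complex plane. For a set $Z\subset\mathbb{C}$, $\pi_0(Z)$ denotes the collection of connected components of $Z$. Let $X\subseteq\mathbb{C}$ be a continuum such that $\pi_0(\mathbb{C}\setminus X)$ is finite. A good cut of $X$ is a simple closed curve $\gamma:[0,1]\to\hat{\mathbb{C}}$ (identified with its image; it may pass through $\infty$) such that $\gamma\cap\partial X$ is a nonempty finite set and $\gamma\setminus X$ is nonempty. Two points $x,y\in X$ are separated by a good cut $\gamma$ of $X$ if they belong to distinct components of $\mathbb{C}\setminus\gamma$. The pseudo-fiber $E_x$ of $x\in X$ is the set of all points $y\in X$ such that $x$ and $y$ are not separated by any good cut of $X$. The fiber $F_x$ is the connected component of $E_x$ that contains $x$. One says that $E_x$ (respectively $F_x$) is trivial if it equals $\{x\}$. *)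

theory Defs
  imports "HOL-Analysis.Analysis"
begin

text \<open>
  The extended complex plane is the one-point compactification of \<open>\<complex>\<close>;
  its points are \<open>Some z\<close> for \<open>z\<close> in \<open>\<complex>\<close>, and \<open>None\<close>, the point at infinity.
\<close>

abbreviation extended_plane :: "complex option topology" where
  "extended_plane \<equiv> Alexandroff_compactification euclidean"

text \<open>
  The injectivity clause is that of \<^const>\<open>loop_free\<close>, which itself is available only
  for types of class \<^class>\<open>topological_space\<close>.
\<close>

definition simple_closed_curve_in :: "'a topology \<Rightarrow> (real \<Rightarrow> 'a) \<Rightarrow> bool" where
  "simple_closed_curve_in T \<gamma> \<longleftrightarrow>
     pathin T \<gamma> \<and> \<gamma> 0 = \<gamma> 1 \<and>
     (\<forall>s\<in>{0..1}. \<forall>t\<in>{0..1}. \<gamma> s = \<gamma> t \<longrightarrow> s = t \<or> s = 0 \<and> t = 1 \<or> s = 1 \<and> t = 0)"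

text \<open>
  \<open>\<gamma>\<close> minus \<open>X\<close> is taken in the extended plane, so \<open>\<infinity>\<close> counts as a point of it.
\<close>

definition good_cut :: "complex set \<Rightarrow> (real \<Rightarrow> complex option) \<Rightarrow> bool" where
  "good_cut X \<gamma> \<longleftrightarrow>
     simple_closed_curve_in extended_plane \<gamma> \<and>
     finite (\<gamma> ` {0..1} \<inter> Some ` frontier X) \<and>
     \<gamma> ` {0..1} \<inter> Some ` frontier X \<noteq> {} \<and>
     \<gamma> ` {0..1} - Some ` X \<noteq> {}"

text \<open>
  The components are those of \<open>\<complex>\<close> minus \<open>\<gamma>\<close>, a subset of the finite plane;
  a point on \<open>\<gamma>\<close> lies in none of them.
\<close>

definition separated_by :: "(real \<Rightarrow> complex option) \<Rightarrow> complex \<Rightarrow> complex \<Rightarrow> bool" where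
  "separated_by \<gamma> x y \<longleftrightarrow>
     (\<exists>U \<in> components {z. Some z \<notin> \<gamma> ` {0..1}}.
      \<exists>V \<in> components {z. Some z \<notin> \<gamma> ` {0..1}}. U \<noteq> V \<and> x \<in> U \<and> y \<in> V)"

definition pseudo_fiber :: "complex set \<Rightarrow> complex \<Rightarrow> complex set" where
  "pseudo_fiber X x = {y \<in> X. \<not> (\<exists>\<gamma>. good_cut X \<gamma> \<and> separated_by \<gamma> x y)}"

definition fiber :: "complex set \<Rightarrow> complex \<Rightarrow> complex set" where
  "fiber X x = connected_component_set (pseudo_fiber X x) x"

end

theory Submission
  imports Defs "HOL-Complex_Analysis.Riemann_Mapping"
begin

text \<open>
  Suppose \<open>X\<close> is locally connected. Three pairwise disjoint subcontinua of \<open>X\<close> cannot all be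
  accessible from three disjoint domains in the complement, because \<open>K\<^sub>3\<^sub>,\<^sub>3\<close> is not planar.
  Hence in a small disc, which contains no component of the complement of \<open>X\<close>, only finitely
  many components of the disc minus \<open>X\<close> come near the centre, and their boundary points are
  accessible. A path in the disc is therefore replaced, component by component, by one that
  meets \<open>\<partial>X\<close> in a finite set. Doing this along a circle around a point of \<open>\<partial>X\<close>, in
  logarithmic coordinates, yields a good cut around that point.

  If \<open>X\<close> is not locally connected at \<open>x\<close>, there are components \<open>Q\<^sub>n\<close> of \<open>X\<close> intersected with
  a disc around \<open>x\<close> that accumulate at a nondegenerate continuum \<open>L\<close> containing \<open>x\<close>. A good
  cut separating \<open>x\<close> from a point of \<open>L\<close> meets infinitely many \<open>Q\<^sub>n\<close>; as it crosses \<open>\<partial>X\<close>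
  finitely often, one of its arcs in \<open>X\<close> joins infinitely many of them inside a larger disc,
  a contradiction. So \<open>L\<close> lies in the fiber of \<open>x\<close>.
\<close>

subsection \<open>Nonplanarity of the complete bipartite graph on three plus three vertices\<close>

text \<open>Finiteness of \<open>components (- X)\<close> gives, around each frontier point of
  \<open>X\<close>, a disc containing no component of the complement. A component of the disc minus
  \<open>X\<close> that comes near the centre must then travel outwards through three prescribed
  distances, and this supplies the edges of the forbidden graph. Holes of \<open>X\<close> at all
  scales, as in the Sierpinski carpet, are what has to be excluded. Editing a circle directly would
  endanger its simplicity and its winding around the centre. In logarithmic coordinates it is enough
  to join two points of a strip that differ by \<open>2 * pi * \<i>\<close>, and being joined by a
  path with finitely many frontier points is an equivalence relation with open classes on the
  connected strip. For the converse two radii are needed: the accumulating components live in the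
  disc of radius \<open>e/2\<close>, the contradiction arises in that of radius \<open>e\<close>, so
  pieces of the cut around a point of the inner disc have room. No good cut separates
  \<open>x\<close> from any point of \<open>L\<close>, and \<open>L\<close> is connected, which is
  why it lies in the fiber and not merely in the pseudo-fiber.\<close>

lemma first_hit:
  fixes f :: "real \<Rightarrow> 'a::topological_space"
  assumes "continuous_on {a..b} f" "closed S" "a \<le> b" "f b \<in> S"
  obtains r where "r \<in> {a..b}" "f r \<in> S" "\<And>t. \<lbrakk>a \<le> t; t < r\<rbrakk> \<Longrightarrow> f t \<notin> S"
proof -
  define T where "T = {a..b} \<inter> f -` S"
  have "closed T"
    unfolding T_def by (intro continuous_closed_preimage assms closed_atLeastAtMost)
  moreover have "bounded T"
    unfolding T_def by (intro bounded_Int) auto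
  ultimately have "compact T" by (simp add: compact_eq_bounded_closed)
  moreover have "b \<in> T" using assms by (simp add: T_def)
  ultimately obtain r where r: "r \<in> T" "\<forall>t\<in>T. r \<le> t"
    using compact_attains_inf[of T] by blast
  show ?thesis
  proof (rule that[of r])
    show "f t \<notin> S" if "a \<le> t" "t < r" for t
      using r that by (force simp: T_def)
  qed (use r in \<open>auto simp: T_def\<close>)
qed

lemma last_hit:
  fixes f :: "real \<Rightarrow> 'a::topological_space"
  assumes "continuous_on {a..b} f" "closed S" "a \<le> b" "f a \<in> S"
  obtains r where "r \<in> {a..b}" "f r \<in> S" "\<And>t. \<lbrakk>r < t; t \<le> b\<rbrakk> \<Longrightarrow> f t \<notin> S"
proof -
  have "continuous_on {-b..-a} (f \<circ> uminus)"
    by (intro continuous_on_compose continuous_intros) (use assms(1) in simp)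
  then obtain r where "r \<in> {-b..-a}" "(f \<circ> uminus) r \<in> S"
      "\<And>t. \<lbrakk>-b \<le> t; t < r\<rbrakk> \<Longrightarrow> (f \<circ> uminus) t \<notin> S"
    using first_hit[of "-b" "-a" "f \<circ> uminus" S] assms by auto
  then show ?thesis
  proof (intro that[of "-r"])
    show "f t \<notin> S" if "- r < t" "t \<le> b" for t
      using \<open>\<And>t. \<lbrakk>-b \<le> t; t < r\<rbrakk> \<Longrightarrow> (f \<circ> uminus) t \<notin> S\<close>[of "-t"] that by auto
  qed auto
qed

lemma connected_neighbourhood_avoiding_closed:
  fixes N F :: "'a::euclidean_space set"
  assumes "compact N" "connected N" "closed F" "N \<inter> F = {}"
  obtains O' where "open O'" "connected O'" "N \<subseteq> O'" "closure O' \<inter> F = {}"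
proof (cases "N = {}")
  case True
  then show ?thesis using that[of "{}"] by auto
next
  case False
  obtain d where d: "d > 0" "\<And>x y. \<lbrakk>x \<in> N; y \<in> F\<rbrakk> \<Longrightarrow> d \<le> dist x y"
    using separate_compact_closed[OF assms(1,3,4)] by metis
  define O' where "O' = (\<Union>x\<in>N. ball x (d/2))"
  have NO: "N \<subseteq> O'" using d(1) by (auto simp: O'_def)
  have "O' = \<Union>((\<lambda>x. N \<union> ball x (d/2)) ` N)" 
    using NO False by (auto simp: O'_def)
  moreover have "connected (\<Union>((\<lambda>x. N \<union> ball x (d/2)) ` N))"
  proof (rule connected_Union)
    show "\<Inter> ((\<lambda>x. N \<union> ball x (d/2)) ` N) \<noteq> {}" using False by auto
    show "connected S" if "S \<in> (\<lambda>x. N \<union> ball x (d/2)) ` N" for S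
    proof -
      from that obtain x where x: "x \<in> N" "S = N \<union> ball x (d/2)" by blast
      then have "x \<in> N \<inter> ball x (d/2)" using d(1) by simp
      then show ?thesis unfolding x(2) using assms(2) by (intro connected_Un connected_ball) auto
    qed
  qed
  moreover have "closure O' \<inter> F = {}"
  proof (rule ccontr)
    assume "closure O' \<inter> F \<noteq> {}"
    then obtain z where z: "z \<in> closure O'" "z \<in> F" by auto
    then obtain w where w: "w \<in> O'" "dist w z < d/2"
      using d(1) by (metis closure_approachable half_gt_zero)
    then obtain x where "x \<in> N" "dist x w < d/2" by (auto simp: O'_def)
    with w d(2)[of x z] z show False using dist_triangle[of x z w] by auto
  qed
  ultimately show ?thesis using that[of O'] NO by (auto simp: O'_def)
qed

text \<open>\<open>V\<close> is to serve as a vertex of degree three: \<open>\<tau> s\<close> is the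
  vertex, the halves of \<open>\<tau>\<close> are two edges and \<open>Y\<close> is the third.
  \<open>Y\<close> omits its landing point, so that it is disjoint from the arc and yet has
  \<open>\<tau> s\<close> in its closure.\<close>

lemma tripod:
  fixes V :: "'a::euclidean_space set"
  assumes V: "V \<noteq> {}" "a1 \<notin> V" "a2 \<notin> V" "a3 \<notin> V" "a1 \<noteq> a2" "a3 \<noteq> a1" "a3 \<noteq> a2"
    and pc: "path_connected (insert a1 V)" "path_connected (insert a2 V)" "path_connected (insert a3 V)"
  obtains \<tau> s Y where "arc \<tau>" "pathstart \<tau> = a1" "pathfinish \<tau> = a2"
    "\<tau> ` {0<..<1} \<subseteq> V" "0 < s" "s < 1" "connected Y" "a3 \<in> Y"
    "Y \<subseteq> insert a3 V" "compact (insert (\<tau> s) Y)" "Y \<inter> path_image \<tau> = {}" "\<tau> s \<in> closure Y"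
proof -
  obtain v where v: "v \<in> V" using V by auto
  obtain g1 where g1: "path g1" "path_image g1 \<subseteq> insert a1 V" "pathstart g1 = a1" "pathfinish g1 = v"
    using pc(1) v unfolding path_connected_def by blast
  obtain g2 where g2: "path g2" "path_image g2 \<subseteq> insert a2 V" "pathstart g2 = v" "pathfinish g2 = a2"
    using pc(2) v unfolding path_connected_def by blast
  obtain \<tau> where \<tau>: "arc \<tau>" "path_image \<tau> \<subseteq> path_image (g1 +++ g2)" "pathstart \<tau> = a1" "pathfinish \<tau> = a2"
    using path_contains_arc[of "g1 +++ g2" a1 a2] g1 g2 V by auto
  then have im: "path_image \<tau> \<subseteq> insert a1 (insert a2 V)"
    using g1 g2 by (auto simp: path_image_join)
  have inV: "\<tau> t \<in> V" if "0 < t" "t < 1" for t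
  proof -
    have "\<tau> t \<in> path_image \<tau>" using that by (auto simp: path_image_def)
    moreover have "\<tau> t \<noteq> \<tau> 0" "\<tau> t \<noteq> \<tau> 1"
      using \<tau>(1) that by (auto simp: arc_def dest: inj_onD)
    ultimately show ?thesis using im \<tau> by (auto simp: pathstart_def pathfinish_def)
  qed
  obtain p where p: "path p" "path_image p \<subseteq> insert a3 V" "pathstart p = a3" "pathfinish p = \<tau> (1/2)"
  proof -
    have "\<tau> (1/2) \<in> insert a3 V" using inV[of "1/2"] by simp
    then show ?thesis using pc(3) that unfolding path_connected_def by blast
  qed
  have cp: "continuous_on {0..1} p" using p by (simp add: path_def)
  have cl: "closed (path_image \<tau>)" using \<tau> arc_imp_path closed_path_image by blast
  have "p 1 \<in> path_image \<tau>" using p by (auto simp: pathfinish_def path_image_def)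
  then obtain u where u: "u \<in> {0..1}" "p u \<in> path_image \<tau>" "\<And>t. \<lbrakk>0 \<le> t; t < u\<rbrakk> \<Longrightarrow> p t \<notin> path_image \<tau>"
    using first_hit[OF cp cl] by auto
  have a3: "a3 \<notin> path_image \<tau>" using im V by auto
  then have u0: "u > 0" using u p by (cases "u = 0") (auto simp: pathstart_def)
  have "p u \<in> path_image p" using u by (simp add: path_image_def)
  then have "p u \<in> V" using p(2) u(2) a3 by blast
  obtain s where s: "s \<in> {0..1}" "p u = \<tau> s" using u by (auto simp: path_image_def)
  have "s \<noteq> 0" "s \<noteq> 1" using s \<open>p u \<in> V\<close> V \<tau> by (auto simp: pathstart_def pathfinish_def)
  then have "0 < s" "s < 1" using s by auto
  have sub: "{0..u} \<subseteq> {0..1}" using u by auto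
  have inV': "\<tau> ` {0<..<1} \<subseteq> V" using inV by auto
  show ?thesis
  proof (rule that[OF \<tau>(1,3,4) inV' \<open>0 < s\<close> \<open>s < 1\<close>, of "p ` {0..<u}"])
    show "connected (p ` {0..<u})"
      by (intro connected_continuous_image continuous_on_subset[OF cp]) (use u in auto)
    show "a3 \<in> p ` {0..<u}" using p u0 by (force simp: pathstart_def)
    have "p ` {0..<u} \<subseteq> path_image p" using u by (auto simp: path_image_def)
    then show "p ` {0..<u} \<subseteq> insert a3 V" using p(2) by blast
    have "{0..u} = insert u {0..<u}" using u0 by auto
    then have "insert (\<tau> s) (p ` {0..<u}) = p ` {0..u}" using s by simp
    then show "compact (insert (\<tau> s) (p ` {0..<u}))"
      by (auto intro!: compact_continuous_image continuous_on_subset[OF cp sub])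
    show "p ` {0..<u} \<inter> path_image \<tau> = {}" using u by auto
    have "p ` closure {0..<u} \<subseteq> closure (p ` {0..<u})"
      by (rule image_closure_subset) (use u0 in \<open>auto intro!: continuous_on_subset[OF cp sub] simp: closure_subset\<close>)
    moreover have "p u \<in> p ` closure {0..<u}" using u0 by simp
    ultimately show "\<tau> s \<in> closure (p ` {0..<u})" using s by auto
  qed
qed

lemma in_closure_imp_connected_insert:
  assumes "connected S" "x \<in> closure S"
  shows "connected (insert x S)"
  by (rule connected_intermediate_closure[OF assms(1)]) (use closure_subset[of S] assms in auto)

lemma near_start:
  fixes f :: "real \<Rightarrow> 'a::metric_space"
  assumes "continuous_on {0..1} f" "open U" "f 0 \<in> U" "0 < s" "s \<le> 1"
  obtains x where "0 < x" "x < s" "f x \<in> U"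
proof -
  obtain e where e: "e > 0" "ball (f 0) e \<subseteq> U" using assms openE by blast
  obtain d where d: "d > 0" "\<And>t. \<lbrakk>t \<in> {0..1}; dist t 0 < d\<rbrakk> \<Longrightarrow> dist (f t) (f 0) < e"
    using assms(1) e(1) unfolding continuous_on_iff
    by (metis atLeastAtMost_iff order.refl zero_le_one)
  define x where "x = min (d/2) (s/2)"
  have "0 < x" "x < s" "x < d" using d assms by (auto simp: x_def min_def)
  then have "f x \<in> U" using d(2)[of x] e assms by (auto simp: dist_commute)
  then show ?thesis using that \<open>0 < x\<close> \<open>x < s\<close> by blast
qed

lemma near_finish:
  fixes f :: "real \<Rightarrow> 'a::metric_space"
  assumes "continuous_on {0..1} f" "open U" "f 1 \<in> U" "0 \<le> s" "s < 1"
  obtains x where "s < x" "x < 1" "f x \<in> U"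
proof -
  have "continuous_on {0..1} (f \<circ> (-) 1)"
    by (intro continuous_on_compose continuous_intros) (use assms(1) in simp)
  then obtain x where "0 < x" "x < 1 - s" "(f \<circ> (-) 1) x \<in> U"
    using near_start[of "f \<circ> (-) 1" U "1 - s"] assms by auto
  then show ?thesis by (intro that[of "1 - x"]) auto
qed

section \<open>Chords on one side of a Jordan curve\<close>

text \<open>The chords may run inside or outside the curve. Naming the sides by the point
  \<open>z\<close> treats both cases at once; \<open>W'\<close> is the side opposite to
  \<open>z\<close>.\<close>

lemma Jordan_side:
  fixes J :: "real \<Rightarrow> complex"
  assumes "simple_path J" "pathfinish J = pathstart J" "z \<notin> path_image J"
  obtains W W' where "open W" "open W'" "connected W" "connected W'" "W' \<noteq> {}" "W \<inter> W' = {}"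
    "W \<union> W' = - path_image J" "frontier W' = path_image J" "z \<in> W"
proof (cases "z \<in> inside (path_image J)")
  case True
  then show ?thesis
    using Jordan_inside_outside[OF assms(1,2)] True
    by (intro that[of "inside (path_image J)" "outside (path_image J)"]) simp_all
next
  case False
  then have z: "z \<in> outside (path_image J)" using assms(3) inside_Un_outside[of "path_image J"] by blast
  show ?thesis
    using Jordan_inside_outside[OF assms(1,2)] z
    by (intro that[of "outside (path_image J)" "inside (path_image J)"]) (simp_all add: Un_commute Int_commute)
qed

lemma connected_subset_open_part:
  assumes "connected T" "T \<subseteq> W \<union> W'" "open W" "open W'" "W \<inter> W' = {}" "T \<inter> W \<noteq> {}"
  shows "T \<subseteq> W"
proof -
  have "W \<inter> T = {} \<or> W' \<inter> T = {}" using assms by (intro connectedD) auto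
  then show ?thesis using assms by blast
qed

text \<open>After its first point in \<open>S\<close> the path may pass to the other side, so it is
  cut there. Before that point it stays in \<open>W\<close> by connectedness, and the cutting point
  lies in \<open>K\<close> because \<open>g\<close> meets \<open>S\<close> nowhere else.\<close>

lemma chord_up_to_first_hit:
  fixes g :: "real \<Rightarrow> complex"
  assumes g: "path g" "pathstart g = c" "pathfinish g \<in> K" "path_image g \<inter> S \<subseteq> K" "K \<subseteq> S" "closed S"
    and W: "W \<union> W' = - S" "open W" "open W'" "W \<inter> W' = {}" "c \<in> W"
  obtains G where "compact G" "connected G" "c \<in> G" "G \<inter> K \<noteq> {}" "G \<subseteq> path_image g" "G \<inter> W' = {}"
proof -
  have cg: "continuous_on {0..1} g" using g by (simp add: path_def)
  have "g 1 \<in> S" using g by (auto simp: pathfinish_def)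
  then obtain u where u: "u \<in> {0..1}" "g u \<in> S" "\<And>t. \<lbrakk>0 \<le> t; t < u\<rbrakk> \<Longrightarrow> g t \<notin> S"
    using first_hit[OF cg \<open>closed S\<close>] by auto
  have im: "g ` {0..u} \<subseteq> path_image g" using u by (auto simp: path_image_def)
  have cu: "continuous_on {0..u} g" "continuous_on {0..<u} g"
    by (rule continuous_on_subset[OF cg]; use u in auto)+
  have g0: "g 0 = c" using g by (simp add: pathstart_def)
  have "0 < u" using u W g0 by (cases "u = 0") auto
  have "g ` {0..<u} \<subseteq> W"
  proof (rule connected_subset_open_part[OF _ _ W(2,3,4)])
    show "connected (g ` {0..<u})" by (rule connected_continuous_image[OF cu(2)]) auto
    show "g ` {0..<u} \<subseteq> W \<union> W'" using u W(1) by auto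
    have "g 0 \<in> g ` {0..<u}" using \<open>0 < u\<close> by auto
    then show "g ` {0..<u} \<inter> W \<noteq> {}" using g0 W(5) by auto
  qed
  moreover have "{0..u} = insert u {0..<u}" using \<open>0 < u\<close> by auto
  ultimately have "g ` {0..u} \<inter> W' = {}" using u(2) W(1,4) by auto
  moreover have gu: "g u \<in> g ` {0..u}" "g 0 \<in> g ` {0..u}" using u by auto
  then have "g u \<in> K" using im u g by blast
  with gu(1) have "g ` {0..u} \<inter> K \<noteq> {}" by blast
  ultimately show ?thesis
    using that[of "g ` {0..u}"] im gu g0 compact_continuous_image[OF cu(1)] connected_continuous_image[OF cu(1)]
    by auto
qed

text \<open>In the intended picture \<open>A1\<close>, \<open>K2\<close>, \<open>A2\<close>,
  \<open>K1\<close> follow each other around \<open>J\<close>, so the chord through \<open>c\<close>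
  from \<open>K1\<close> to \<open>K2\<close> and the chord \<open>Y\<close> from \<open>A1\<close>
  to \<open>A2\<close> are linked and, lying on one side, ought to meet. If they do not, the far
  side can be joined to \<open>y\<close> off each half of \<open>J\<close> completed by the first
  chord, hence off all of \<open>J\<close>.\<close>

lemma linked_chords_meet:
  fixes J :: "real \<Rightarrow> complex"
  assumes J: "simple_path J" "pathfinish J = pathstart J" "path_image J = A1 \<union> K2 \<union> A2 \<union> K1"
    and A: "compact A1" "compact A2" "compact K1" "compact K2" "connected K1" "connected K2" "A1 \<inter> A2 = {}"
    and g1: "path g1" "pathstart g1 = c" "pathfinish g1 \<in> K1" "path_image g1 \<inter> path_image J \<subseteq> K1"
    and g2: "path g2" "pathstart g2 = c" "pathfinish g2 \<in> K2" "path_image g2 \<inter> path_image J \<subseteq> K2"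
    and Y: "connected Y" "Y \<inter> path_image J = {}" "Y \<inter> (path_image g1 \<union> path_image g2) = {}"
    and c1: "c1 \<in> closure Y" "c1 \<in> A1" "c1 \<notin> K1 \<union> K2 \<union> path_image g1 \<union> path_image g2"
    and c2: "c2 \<in> closure Y" "c2 \<in> A2" "c2 \<notin> K1 \<union> K2 \<union> path_image g1 \<union> path_image g2"
    and cY: "y \<in> Y" "connected_component (- path_image J) c y"
  shows False
proof -
  let ?S = "path_image J"
  have cS: "closed ?S" using J(1) closed_simple_path_image by blast
  have "c \<notin> ?S" using cY connected_component_in by blast
  then obtain W W' where W: "open W" "open W'" "connected W" "connected W'" "W' \<noteq> {}" "W \<inter> W' = {}"
    "W \<union> W' = - ?S" "frontier W' = ?S" "c \<in> W"
    using Jordan_side[OF J(1,2)] by metis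
  obtain G1 where G1: "compact G1" "connected G1" "c \<in> G1" "G1 \<inter> K1 \<noteq> {}" "G1 \<subseteq> path_image g1" "G1 \<inter> W' = {}"
    using chord_up_to_first_hit[OF g1 _ cS W(7,1,2,6,9)] J(3) by blast
  obtain G2 where G2: "compact G2" "connected G2" "c \<in> G2" "G2 \<inter> K2 \<noteq> {}" "G2 \<subseteq> path_image g2" "G2 \<inter> W' = {}"
    using chord_up_to_first_hit[OF g2 _ cS W(7,1,2,6,9)] J(3) by blast
  define C where "C = (K1 \<union> G1) \<union> (G2 \<union> K2)"
  have C: "compact C" "connected C" "C \<inter> W' = {}" "C \<inter> Y = {}"
  proof -
    show "compact C" unfolding C_def by (intro compact_Un A G1 G2)
    show "connected C" unfolding C_def
      by (intro connected_Un A G1 G2) (use G1 G2 in auto)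
    have "(K1 \<union> K2) \<inter> W' = {}" using W(7) J(3) by blast
    then show "C \<inter> W' = {}" unfolding C_def using G1(6) G2(6) by blast
    show "C \<inter> Y = {}" unfolding C_def using G1(5) G2(5) Y J(3) by blast
  qed
  have cC: "c1 \<notin> C" "c2 \<notin> C" unfolding C_def using c1 c2 G1 G2 by auto
  obtain p where p: "p \<in> W'" using W by auto
  have clW: "a \<in> closure W'" if "a \<in> ?S" for a using that W(8) by (auto simp: frontier_def)
  \<comment> \<open>The far side is left at a single point \<open>a\<close> of \<open>J\<close>: it
    is a frontier point of \<open>W'\<close> and a closure point of \<open>Y\<close>, so adding it
    keeps both connected.\<close>
  have join: "connected_component (- (A \<union> C)) p y"
    if "a \<in> closure Y" "a \<in> ?S" "a \<notin> A" "a \<notin> C" "A \<subseteq> ?S" for a A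
  proof -
    have "connected (insert a W' \<union> insert a Y)"
      using in_closure_imp_connected_insert[OF W(4) clW[OF that(2)]] in_closure_imp_connected_insert[OF Y(1) that(1)]
      by (intro connected_Un) auto
    moreover have "insert a W' \<union> insert a Y \<subseteq> - (A \<union> C)"
      using that C W(7) Y(2) by blast
    ultimately show ?thesis using p cY unfolding connected_component_def by blast
  qed
  \<comment> \<open>\<open>A1\<close> is avoided by crossing at \<open>c2\<close>, and
    \<open>A2\<close> by crossing at \<open>c1\<close>.\<close>
  have "connected_component (- (A1 \<union> C)) p y" by (rule join[of c2]) (use c2 cC A J in auto)
  moreover have "connected_component (- (A2 \<union> C)) p y" by (rule join[of c1]) (use c1 cC A J in auto)
  \<comment> \<open>Janiszewski's theorem asks for a connected intersection; here it is the
    chord.\<close>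
  moreover have "(A1 \<union> C) \<inter> (A2 \<union> C) = C" using A by blast
  ultimately have "connected_component (- ((A1 \<union> C) \<union> (A2 \<union> C))) p y"
    using A C by (intro Janiszewski[of "A1 \<union> C" "A2 \<union> C"] compact_Un compact_imp_closed) auto
  then have "connected_component (- ?S) p y"
    by (rule connected_component_of_subset) (auto simp: C_def J(3))
  then have "connected_component (- ?S) c p" using cY by (meson connected_component_sym connected_component_trans)
  then obtain T where T: "connected T" "T \<subseteq> - ?S" "c \<in> T" "p \<in> T" by (auto simp: connected_component_def)
  have "T \<subseteq> W" by (rule connected_subset_open_part[OF T(1) _ W(1,2,6)]) (use T W in auto)
  then show False using T p W(6) by auto
qed

lemma compact_path_connected_triple:
  fixes S :: "'a::real_normed_vector set"
  assumes "path_connected S" "a \<in> S" "b \<in> S" "c \<in> S"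
  obtains P where "compact P" "path_connected P" "a \<in> P" "b \<in> P" "c \<in> P" "P \<subseteq> S"
proof -
  obtain p where p: "path p" "path_image p \<subseteq> S" "pathstart p = a" "pathfinish p = b"
    using assms(1)[unfolded path_connected_def, rule_format, OF assms(2,3)] by blast
  obtain q where q: "path q" "path_image q \<subseteq> S" "pathstart q = b" "pathfinish q = c"
    using assms(1)[unfolded path_connected_def, rule_format, OF assms(3,4)] by blast
  have m: "a \<in> path_image p" "b \<in> path_image p" "b \<in> path_image q" "c \<in> path_image q"
    using p q pathfinish_in_path_image pathstart_in_path_image by metis+
  have "path_connected (path_image p \<union> path_image q)"
    by (intro path_connected_Un path_connected_path_image p(1) q(1)) (use m in auto)
  then show ?thesis
    by (rule that[of "path_image p \<union> path_image q", rotated]) (use p q m in \<open>auto simp: compact_path_image\<close>)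
qed

lemma arc_half_images:
  assumes "\<tau> ` {0<..<1} \<subseteq> V" "0 < s" "s < 1"
  shows "\<tau> ` {s..1} \<subseteq> insert (pathfinish \<tau>) V" "\<tau> ` {0..s} \<subseteq> insert (pathstart \<tau>) V"
proof -
  have "{s..1} \<subseteq> insert 1 {0<..<1}" "{0..s} \<subseteq> insert 0 {0<..<1}" using assms(2,3) by auto
  then have "\<tau> ` {s..1} \<subseteq> insert (\<tau> 1) (\<tau> ` {0<..<1})" "\<tau> ` {0..s} \<subseteq> insert (\<tau> 0) (\<tau> ` {0<..<1})"
    by (metis image_insert image_mono)+
  with assms(1) show "\<tau> ` {s..1} \<subseteq> insert (pathfinish \<tau>) V" "\<tau> ` {0..s} \<subseteq> insert (pathstart \<tau>) V"
    unfolding pathstart_def pathfinish_def by blast+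
qed

text \<open>Cutting at the last point of \<open>P\<close> before \<open>s\<close> and at the first
  point of \<open>Q\<close> after \<open>s\<close> leaves an arc that meets each set only in an end,
  so it can be glued to arcs inside \<open>P\<close> and \<open>Q\<close> without new
  intersections.\<close>

lemma trim_arc:
  fixes \<tau> :: "real \<Rightarrow> 'a::topological_space"
  assumes "continuous_on {0..1} \<tau>" "0 < x" "x < s" "s < y" "y < 1" "closed P" "closed Q" "\<tau> x \<in> P" "\<tau> y \<in> Q"
    and off: "\<tau> ` {s..1} \<inter> P = {}" "\<tau> ` {0..s} \<inter> Q = {}"
  obtains l r where "0 < l" "l < s" "s < r" "r < 1" "\<tau> l \<in> P" "\<tau> r \<in> Q"
    "\<tau> ` {l..r} \<inter> P = {\<tau> l}" "\<tau> ` {l..r} \<inter> Q = {\<tau> r}"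
proof -
  have c: "continuous_on {x..s} \<tau>" "continuous_on {s..y} \<tau>"
    by (rule continuous_on_subset[OF assms(1)]; use assms in auto)+
  obtain l where l: "l \<in> {x..s}" "\<tau> l \<in> P" "\<And>t. \<lbrakk>l < t; t \<le> s\<rbrakk> \<Longrightarrow> \<tau> t \<notin> P"
    using last_hit[OF c(1) \<open>closed P\<close> _ \<open>\<tau> x \<in> P\<close>] \<open>x < s\<close> less_imp_le by metis
  obtain r where r: "r \<in> {s..y}" "\<tau> r \<in> Q" "\<And>t. \<lbrakk>s \<le> t; t < r\<rbrakk> \<Longrightarrow> \<tau> t \<notin> Q"
    using first_hit[OF c(2) \<open>closed Q\<close> _ \<open>\<tau> y \<in> Q\<close>] \<open>s < y\<close> less_imp_le by metis
  have offP: "\<tau> t \<notin> P" if "s \<le> t" "t \<le> 1" for t using off(1) that by force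
  have offQ: "\<tau> t \<notin> Q" if "0 \<le> t" "t \<le> s" for t using off(2) that by force
  have "l \<noteq> s" "r \<noteq> s" using l r offP[of s] offQ[of s] assms by auto
  then have lr: "0 < l" "l < s" "s < r" "r < 1" using l r assms by auto
  have "\<tau> t \<notin> P" if "l < t" "t \<le> r" for t using l(3)[of t] offP[of t] that lr by linarith
  then have 1: "\<tau> ` {l..r} \<inter> P = {\<tau> l}" using l(2) lr by (force simp: le_less)
  have "\<tau> t \<notin> Q" if "l \<le> t" "t < r" for t using r(3)[of t] offQ[of t] that lr by linarith
  then have 2: "\<tau> ` {l..r} \<inter> Q = {\<tau> r}" using r(2) lr by (force simp: le_less)
  show ?thesis using that[OF lr l(2) r(2) 1 2] .
qed

lemma simple_closed_path_of_four_arcs: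
  fixes a b k h :: "real \<Rightarrow> 'a::t2_space"
  assumes arcs: "arc a" "arc k" "arc b" "arc h"
    and ends: "pathfinish a = pathstart k" "pathfinish b = pathfinish k" "pathstart b = pathfinish h" "pathstart a = pathstart h"
    and disj: "path_image a \<inter> path_image b = {}" "path_image k \<inter> path_image h = {}"
      "path_image a \<inter> path_image k \<subseteq> {pathstart k}" "path_image b \<inter> path_image k \<subseteq> {pathfinish k}"
      "path_image a \<inter> path_image h \<subseteq> {pathstart h}" "path_image b \<inter> path_image h \<subseteq> {pathfinish h}"
  obtains J where "simple_path J" "pathfinish J = pathstart J"
    "path_image J = path_image a \<union> path_image k \<union> path_image b \<union> path_image h"
proof -
  let ?g = "a +++ k" and ?h = "reversepath b +++ reversepath h"
  have "arc ?g" using arcs ends disj by (intro arc_join) auto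
  moreover have "arc ?h" using arcs ends disj by (intro arc_join) (auto simp: arc_reversepath)
  moreover have "path_image ?g = path_image a \<union> path_image k" "path_image ?h = path_image b \<union> path_image h"
    using ends by (auto simp: path_image_join)
  moreover from this have "path_image ?g \<inter> path_image ?h \<subseteq> {pathstart ?g, pathstart ?h}"
    using disj ends by auto
  ultimately have "simple_path (?g +++ ?h)" "path_image (?g +++ ?h) = path_image a \<union> path_image k \<union> path_image b \<union> path_image h"
    using ends by (auto intro!: simple_path_join_loop simp: path_image_join)
  then show ?thesis using ends by (intro that[of "?g +++ ?h"]) auto
qed

text \<open>
  A Jordan curve \<open>J\<close> runs through \<open>V1\<close>, \<open>N2\<close>, \<open>V2\<close>, \<open>N1\<close>, and both \<open>V3\<close> and \<open>N3\<close> supply chords of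
  \<open>J\<close> on one of its sides. Janiszewski's theorem, applied to the two halves of \<open>J\<close> each
  completed by the chord \<open>C\<close> through \<open>V3\<close>, then joins the other side of \<open>J\<close> to \<open>N3\<close>
  off \<open>J\<close>.
\<close>

lemma no_planar_K33:
  fixes N1 N2 N3 V1 V2 V3 :: "complex set"
  assumes N: "compact N1" "compact N2" "compact N3" "connected N1" "connected N2" "connected N3"
    and Ndisj: "N1 \<inter> N2 = {}" "N1 \<inter> N3 = {}" "N2 \<inter> N3 = {}"
    and Vdisj: "V1 \<inter> V2 = {}" "V1 \<inter> V3 = {}" "V2 \<inter> V3 = {}"
    and Vne: "V1 \<noteq> {}" "V2 \<noteq> {}" "V3 \<noteq> {}"
    and NV: "(N1 \<union> N2 \<union> N3) \<inter> (V1 \<union> V2 \<union> V3) = {}"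
    and acc1: "a11 \<in> N1" "a12 \<in> N2" "a13 \<in> N3" "path_connected (insert a11 V1)"
       "path_connected (insert a12 V1)" "path_connected (insert a13 V1)"
    and acc2: "a21 \<in> N1" "a22 \<in> N2" "a23 \<in> N3" "path_connected (insert a21 V2)"
       "path_connected (insert a22 V2)" "path_connected (insert a23 V2)"
    and acc3: "a31 \<in> N1" "a32 \<in> N2" "a33 \<in> N3" "path_connected (insert a31 V3)"
       "path_connected (insert a32 V3)" "path_connected (insert a33 V3)"
  shows False
proof -
  have h1: "a11 \<notin> V1" "a12 \<notin> V1" "a13 \<notin> V1" "a11 \<noteq> a12" "a13 \<noteq> a11" "a13 \<noteq> a12"
    using NV Ndisj acc1(1-3) by (blast, blast, blast, blast, blast, blast)
  have h2: "a21 \<notin> V2" "a22 \<notin> V2" "a23 \<notin> V2" "a21 \<noteq> a22" "a23 \<noteq> a21" "a23 \<noteq> a22"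
    using NV Ndisj acc2(1-3) by (blast, blast, blast, blast, blast, blast)
  obtain \<tau>1 s1 Y1 where \<tau>1: "arc \<tau>1" "pathstart \<tau>1 = a11" "pathfinish \<tau>1 = a12"
    "\<tau>1 ` {0<..<1} \<subseteq> V1" "0 < s1" "s1 < 1" "connected Y1" "a13 \<in> Y1"
    "Y1 \<subseteq> insert a13 V1" "compact (insert (\<tau>1 s1) Y1)" "Y1 \<inter> path_image \<tau>1 = {}" "\<tau>1 s1 \<in> closure Y1"
    by (rule tripod[OF Vne(1) h1 acc1(4-6)])
  obtain \<tau>2 s2 Y2 where \<tau>2: "arc \<tau>2" "pathstart \<tau>2 = a21" "pathfinish \<tau>2 = a22"
    "\<tau>2 ` {0<..<1} \<subseteq> V2" "0 < s2" "s2 < 1" "connected Y2" "a23 \<in> Y2"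
    "Y2 \<subseteq> insert a23 V2" "compact (insert (\<tau>2 s2) Y2)" "Y2 \<inter> path_image \<tau>2 = {}" "\<tau>2 s2 \<in> closure Y2"
    by (rule tripod[OF Vne(2) h2 acc2(4-6)])
  obtain c3 where c3: "c3 \<in> V3" using Vne by auto
  obtain \<beta>1 where \<beta>1: "path \<beta>1" "path_image \<beta>1 \<subseteq> insert a31 V3" "pathstart \<beta>1 = c3" "pathfinish \<beta>1 = a31"
    using acc3(4) c3 unfolding path_connected_def by blast
  obtain \<beta>2 where \<beta>2: "path \<beta>2" "path_image \<beta>2 \<subseteq> insert a32 V3" "pathstart \<beta>2 = c3" "pathfinish \<beta>2 = a32"
    using acc3(5) c3 unfolding path_connected_def by blast
  obtain \<beta>3 where \<beta>3: "path \<beta>3" "path_image \<beta>3 \<subseteq> insert a33 V3" "pathstart \<beta>3 = c3" "pathfinish \<beta>3 = a33"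
    using acc3(6) c3 unfolding path_connected_def by blast
  have c\<tau>: "continuous_on {0..1} \<tau>1" "continuous_on {0..1} \<tau>2"
    using \<tau>1(1) \<tau>2(1) by (auto simp: arc_def path_def)
  have \<tau>V: "\<tau>1 ` {s1..1} \<subseteq> insert a12 V1" "\<tau>2 ` {s2..1} \<subseteq> insert a22 V2"
          "\<tau>1 ` {0..s1} \<subseteq> insert a11 V1" "\<tau>2 ` {0..s2} \<subseteq> insert a21 V2"
    using arc_half_images[OF \<tau>1(4-6)] arc_half_images[OF \<tau>2(4-6)] \<tau>1(2,3) \<tau>2(2,3) by simp_all
  have s1V: "\<tau>1 s1 \<in> V1" and s2V: "\<tau>2 s2 \<in> V2" using \<tau>1 \<tau>2 by auto
  have cl\<tau>: "closed (\<tau>1 ` {s1..1})" "closed (\<tau>2 ` {s2..1})" "closed (\<tau>1 ` {0..s1})" "closed (\<tau>2 ` {0..s2})"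
    using \<tau>1 \<tau>2 by (auto intro!: compact_imp_closed compact_continuous_image continuous_on_subset[OF c\<tau>(1)] continuous_on_subset[OF c\<tau>(2)])
  \<comment> \<open>\<open>N1\<close> and \<open>N2\<close> need not contain arcs, so they are
    fattened to connected open sets \<open>O1\<close> and \<open>O2\<close>, in which arcs exist.
    \<open>F\<close> is what neither may touch: \<open>N3\<close> with the edges leading to
    it.\<close>
  define F where "F = insert (\<tau>1 s1) Y1 \<union> insert (\<tau>2 s2) Y2 \<union> N3 \<union> path_image \<beta>3"
  have clF: "closed F" unfolding F_def
    using \<tau>1(10) \<tau>2(10) N \<beta>3 by (intro closed_Un compact_imp_closed compact_path_image) auto
  have F_sub: "F \<subseteq> V1 \<union> V2 \<union> V3 \<union> N3"
    using \<tau>1(9) \<tau>2(9) \<beta>3(2) s1V s2V acc1(3) acc2(3) acc3(3) unfolding F_def by blast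
  \<comment> \<open>\<open>O1\<close> must also miss whatever leads to \<open>N2\<close>; for this
    the arcs are split at the vertices \<open>\<tau>1 s1\<close> and
    \<open>\<tau>2 s2\<close>.\<close>
  define F1 where "F1 = F \<union> N2 \<union> \<tau>1 ` {s1..1} \<union> \<tau>2 ` {s2..1} \<union> path_image \<beta>2"
  have "closed F1" unfolding F1_def using clF N(2) cl\<tau> \<beta>2
    by (intro closed_Un compact_imp_closed[of "path_image _"] compact_path_image) (auto intro: compact_imp_closed)
  moreover have "F1 \<subseteq> V1 \<union> V2 \<union> V3 \<union> N3 \<union> N2"
    unfolding F1_def using F_sub \<tau>V acc1 acc2 acc3 \<beta>2(2) by blast
  then have "N1 \<inter> F1 = {}" using NV Ndisj by blast
  ultimately obtain O1 where O1: "open O1" "connected O1" "N1 \<subseteq> O1" "closure O1 \<inter> F1 = {}"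
    using connected_neighbourhood_avoiding_closed[OF N(1,4)] by blast
  \<comment> \<open>Including \<open>closure O1\<close> makes the second neighbourhood disjoint from
    the first.\<close>
  define F2 where "F2 = F \<union> closure O1 \<union> \<tau>1 ` {0..s1} \<union> \<tau>2 ` {0..s2} \<union> path_image \<beta>1"
  have "closed F2" unfolding F2_def using clF N(2) cl\<tau> \<beta>1
    by (intro closed_Un compact_imp_closed[of "path_image _"] compact_path_image) auto
  moreover have "N2 \<inter> closure O1 = {}" using O1(4) by (auto simp: F1_def)
  moreover have "F2 \<subseteq> V1 \<union> V2 \<union> V3 \<union> N3 \<union> N1 \<union> closure O1"
    unfolding F2_def using F_sub \<tau>V(3,4) acc1(1) acc2(1) acc3(1) \<beta>1(2) by blast
  then have "N2 \<inter> F2 \<subseteq> N2 \<inter> closure O1" using NV Ndisj by blast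
  ultimately have "closed F2" "N2 \<inter> F2 = {}" by auto
  then obtain O2 where O2: "open O2" "connected O2" "N2 \<subseteq> O2" "closure O2 \<inter> F2 = {}"
    using connected_neighbourhood_avoiding_closed[OF N(2,5)] by blast
  have O1F: "O1 \<inter> F1 = {}" and O2F: "O2 \<inter> F2 = {}" using O1 O2 closure_subset by blast+
  have O12: "O1 \<inter> O2 = {}" using O2F closure_subset[of O1] by (auto simp: F2_def)

  have ends: "\<tau>1 0 \<in> O1" "\<tau>2 0 \<in> O1" "\<tau>1 1 \<in> O2" "\<tau>2 1 \<in> O2"
    using \<tau>1(2,3) \<tau>2(2,3) O1(3) O2(3) acc1 acc2 unfolding pathstart_def pathfinish_def by blast+
  \<comment> \<open>\<open>a11\<close> and \<open>a21\<close> may coincide, so the ends of the arcs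
    are given up: at parameters strictly between 0 and 1 the arcs lie in the disjoint sets
    \<open>V1\<close> and \<open>V2\<close>.\<close>
  obtain x1 where x1: "0 < x1" "x1 < s1" "\<tau>1 x1 \<in> O1"
    using near_start[OF c\<tau>(1) O1(1) ends(1) \<tau>1(5)] \<tau>1(6) by auto
  obtain x2 where x2: "0 < x2" "x2 < s2" "\<tau>2 x2 \<in> O1"
    using near_start[OF c\<tau>(2) O1(1) ends(2) \<tau>2(5)] \<tau>2(6) by auto
  obtain y1 where y1: "s1 < y1" "y1 < 1" "\<tau>1 y1 \<in> O2"
    using near_finish[OF c\<tau>(1) O2(1) ends(3) _ \<tau>1(6)] \<tau>1(5) by auto
  obtain y2 where y2: "s2 < y2" "y2 < 1" "\<tau>2 y2 \<in> O2"
    using near_finish[OF c\<tau>(2) O2(1) ends(4) _ \<tau>2(6)] \<tau>2(5) by auto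
  have a3O: "a31 \<in> O1" "a32 \<in> O2" using O1(3) O2(3) acc3 by auto
  obtain P1 where P1: "compact P1" "path_connected P1" "\<tau>1 x1 \<in> P1" "\<tau>2 x2 \<in> P1" "a31 \<in> P1" "P1 \<subseteq> O1"
    using compact_path_connected_triple[OF connected_open_path_connected[OF O1(1,2)] x1(3) x2(3) a3O(1)] by metis
  obtain P2 where P2: "compact P2" "path_connected P2" "\<tau>1 y1 \<in> P2" "\<tau>2 y2 \<in> P2" "a32 \<in> P2" "P2 \<subseteq> O2"
    using compact_path_connected_triple[OF connected_open_path_connected[OF O2(1,2)] y1(3) y2(3) a3O(2)] by metis
  have off: "\<tau>1 ` {s1..1} \<inter> P1 = {}" "\<tau>2 ` {s2..1} \<inter> P1 = {}" "\<tau>1 ` {0..s1} \<inter> P2 = {}" "\<tau>2 ` {0..s2} \<inter> P2 = {}"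
    using O1F O2F P1(6) P2(6) unfolding F1_def F2_def by blast+
  obtain l1 r1 where lr1: "0 < l1" "l1 < s1" "s1 < r1" "r1 < 1" "\<tau>1 l1 \<in> P1" "\<tau>1 r1 \<in> P2"
    "\<tau>1 ` {l1..r1} \<inter> P1 = {\<tau>1 l1}" "\<tau>1 ` {l1..r1} \<inter> P2 = {\<tau>1 r1}"
    using trim_arc[OF c\<tau>(1) x1(1,2) y1(1,2) compact_imp_closed[OF P1(1)] compact_imp_closed[OF P2(1)] P1(3) P2(3) off(1,3)] by metis
  obtain l2 r2 where lr2: "0 < l2" "l2 < s2" "s2 < r2" "r2 < 1" "\<tau>2 l2 \<in> P1" "\<tau>2 r2 \<in> P2"
    "\<tau>2 ` {l2..r2} \<inter> P1 = {\<tau>2 l2}" "\<tau>2 ` {l2..r2} \<inter> P2 = {\<tau>2 r2}"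
    using trim_arc[OF c\<tau>(2) x2(1,2) y2(1,2) compact_imp_closed[OF P1(1)] compact_imp_closed[OF P2(1)] P1(4) P2(4) off(2,4)] by metis
  define A1 where "A1 = \<tau>1 ` {l1..r1}"
  define A2 where "A2 = \<tau>2 ` {l2..r2}"
  define \<alpha>1 where "\<alpha>1 = subpath l1 r1 \<tau>1"
  define \<alpha>2 where "\<alpha>2 = subpath l2 r2 \<tau>2"
  have \<alpha>: "arc \<alpha>1" "arc \<alpha>2" "path_image \<alpha>1 = A1" "path_image \<alpha>2 = A2"
      "pathstart \<alpha>1 = \<tau>1 l1" "pathfinish \<alpha>1 = \<tau>1 r1" "pathstart \<alpha>2 = \<tau>2 l2" "pathfinish \<alpha>2 = \<tau>2 r2"
    unfolding \<alpha>1_def \<alpha>2_def A1_def A2_def using \<tau>1(1) \<tau>2(1) lr1(1-4) lr2(1-4)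
    by (auto intro!: arc_subpath_arc simp: path_image_subpath)
  have A1: "A1 \<subseteq> V1" and A2: "A2 \<subseteq> V2"
    using \<tau>1(4) \<tau>2(4) lr1(1-4) lr2(1-4) unfolding A1_def A2_def by force+
  have A1\<tau>: "A1 \<subseteq> path_image \<tau>1" and A2\<tau>: "A2 \<subseteq> path_image \<tau>2"
    using lr1(1-4) lr2(1-4) unfolding A1_def A2_def path_image_def by force+
  have mA: "\<tau>1 l1 \<in> A1" "\<tau>1 r1 \<in> A1" "\<tau>1 s1 \<in> A1" "\<tau>2 l2 \<in> A2" "\<tau>2 r2 \<in> A2" "\<tau>2 s2 \<in> A2"
    using lr1(1-4) lr2(1-4) unfolding A1_def A2_def by auto
  have A12: "A1 \<inter> A2 = {}" using A1 A2 Vdisj by blast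
  have "\<tau>1 l1 \<noteq> \<tau>2 l2" "\<tau>1 r1 \<noteq> \<tau>2 r2" using mA A12 by auto
  then obtain k1 k2 where k1: "arc k1" "path_image k1 \<subseteq> P1" "pathstart k1 = \<tau>1 l1" "pathfinish k1 = \<tau>2 l2"
     and k2: "arc k2" "path_image k2 \<subseteq> P2" "pathstart k2 = \<tau>1 r1" "pathfinish k2 = \<tau>2 r2"
    using P1(2) P2(2) lr1(5,6) lr2(5,6) unfolding path_connected_arcwise by metis
  have AP: "A1 \<inter> P1 = {\<tau>1 l1}" "A1 \<inter> P2 = {\<tau>1 r1}" "A2 \<inter> P1 = {\<tau>2 l2}" "A2 \<inter> P2 = {\<tau>2 r2}"
    using lr1 lr2 by (simp_all add: A1_def A2_def)
  have P12: "P1 \<inter> P2 = {}" using P1(6) P2(6) O12 by blast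
  obtain J where J: "simple_path J" "pathfinish J = pathstart J"
    "path_image J = A1 \<union> path_image k2 \<union> A2 \<union> path_image k1"
  proof (rule simple_closed_path_of_four_arcs[OF \<alpha>(1) k2(1) \<alpha>(2) k1(1)])
    show "path_image \<alpha>1 \<inter> path_image \<alpha>2 = {}" using \<alpha> A12 by simp
    show "path_image k2 \<inter> path_image k1 = {}" using k1(2) k2(2) P12 by blast
    show "path_image \<alpha>1 \<inter> path_image k2 \<subseteq> {pathstart k2}" using \<alpha>(3) k2(2,3) AP by auto
    show "path_image \<alpha>2 \<inter> path_image k2 \<subseteq> {pathfinish k2}" using \<alpha>(4) k2(2,4) AP by auto
    show "path_image \<alpha>1 \<inter> path_image k1 \<subseteq> {pathstart k1}" using \<alpha>(3) k1(2,3) AP by auto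
    show "path_image \<alpha>2 \<inter> path_image k1 \<subseteq> {pathfinish k1}" using \<alpha>(4) k1(2,4) AP by auto
  qed (use \<alpha> k1 k2 in auto)
  have B: "path_image \<beta>1 \<subseteq> V3 \<union> N1" "path_image \<beta>2 \<subseteq> V3 \<union> N2" "path_image \<beta>3 \<subseteq> V3 \<union> N3"
    using \<beta>1(2) \<beta>2(2) \<beta>3(2) acc3 by auto
  have ends\<beta>: "c3 \<in> path_image \<beta>1" "c3 \<in> path_image \<beta>2" "c3 \<in> path_image \<beta>3"
     "a31 \<in> path_image \<beta>1" "a32 \<in> path_image \<beta>2" "a33 \<in> path_image \<beta>3"
    using \<beta>1 \<beta>2 \<beta>3 pathstart_in_path_image pathfinish_in_path_image by metis+
  have "path_connected (path_image \<beta>1 \<union> P1)" "path_connected (path_image \<beta>2 \<union> P2)"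
    using ends\<beta> P1(2,5) P2(2,5) by (auto intro!: path_connected_Un path_connected_path_image \<beta>1(1) \<beta>2(1))
  then obtain g1 g2 where g1: "path g1" "path_image g1 \<subseteq> path_image \<beta>1 \<union> P1" "pathstart g1 = c3" "pathfinish g1 = \<tau>1 l1"
    and g2: "path g2" "path_image g2 \<subseteq> path_image \<beta>2 \<union> P2" "pathstart g2 = c3" "pathfinish g2 = \<tau>1 r1"
    using ends\<beta> lr1(5,6) unfolding path_connected_def by (metis UnI1 UnI2)
  have kends: "\<tau>1 l1 \<in> path_image k1" "\<tau>2 l2 \<in> path_image k1" "\<tau>1 r1 \<in> path_image k2" "\<tau>2 r2 \<in> path_image k2"
    using k1 k2 pathstart_in_path_image pathfinish_in_path_image by metis+
  have PF: "P1 \<inter> F = {}" "P2 \<inter> F = {}" "P2 \<inter> path_image \<beta>1 = {}" "P1 \<inter> path_image \<beta>2 = {}"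
    using P1(6) P2(6) O1F O2F unfolding F1_def F2_def by blast+
  have BA: "path_image \<beta>1 \<inter> (A1 \<union> A2) = {}" "path_image \<beta>2 \<inter> (A1 \<union> A2) = {}" "path_image \<beta>3 \<inter> (A1 \<union> A2) = {}"
    using B A1 A2 Vdisj NV by blast+
  \<comment> \<open>The chord from \<open>\<tau>1 s1\<close> to \<open>\<tau>2 s2\<close> through
    \<open>N3\<close>; the other one runs from \<open>k1\<close> to \<open>k2\<close> through
    \<open>c3\<close>.\<close>
  define Y where "Y = (Y1 \<union> N3) \<union> Y2"
  have YF: "Y \<subseteq> F" unfolding Y_def F_def by blast
  have YV: "Y \<subseteq> V1 \<union> V2 \<union> N3" unfolding Y_def using \<tau>1(9) \<tau>2(9) acc1 acc2 by blast
  have YA: "Y \<inter> (A1 \<union> A2) = {}"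
  proof -
    have "Y1 \<inter> A1 = {}" "Y2 \<inter> A2 = {}" using \<tau>1(11) \<tau>2(11) A1\<tau> A2\<tau> by blast+
    moreover have "Y1 \<inter> A2 = {}" "Y2 \<inter> A1 = {}" "N3 \<inter> A1 = {}" "N3 \<inter> A2 = {}"
      using \<tau>1(9) \<tau>2(9) A1 A2 Vdisj NV acc1(3) acc2(3) by blast+
    ultimately show ?thesis unfolding Y_def by blast
  qed
  have conY: "connected Y" unfolding Y_def
    using \<tau>1(7,8) \<tau>2(7,8) N(6) acc1(3) acc2(3) by (intro connected_Un) auto
  have YJ: "Y \<inter> path_image J = {}" using YA YF PF(1,2) k1(2) k2(2) unfolding J(3) by blast
  have YB: "Y \<inter> (path_image \<beta>1 \<union> path_image \<beta>2) = {}"   proof -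
    have "Y \<inter> V3 = {}" using YV Vdisj NV by blast
    moreover have "Y \<inter> N1 = {}" "Y \<inter> N2 = {}" using YV Ndisj NV by blast+
    ultimately show ?thesis using B(1,2) by blast
  qed
  have APk: "A1 \<inter> P1 \<subseteq> path_image k1" "A2 \<inter> P1 \<subseteq> path_image k1"
      "A1 \<inter> P2 \<subseteq> path_image k2" "A2 \<inter> P2 \<subseteq> path_image k2"
    using AP kends by simp_all
  have sF: "\<tau>1 s1 \<in> F" "\<tau>2 s2 \<in> F" unfolding F_def by auto
  show False
  proof (rule linked_chords_meet[OF J, where Y = Y and c = c3 and y = a33 and ?g1.0 = g1 and ?g2.0 = g2 and ?c1.0 = "\<tau>1 s1" and ?c2.0 = "\<tau>2 s2"])
    show "compact A1" "compact A2" using \<alpha> compact_arc_image by metis+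
    show "compact (path_image k1)" "compact (path_image k2)" "connected (path_image k1)" "connected (path_image k2)"
      using k1(1) k2(1) by (simp_all add: compact_arc_image connected_arc_image)
    show "path_image g1 \<inter> path_image J \<subseteq> path_image k1"
    proof -
      have "path_image \<beta>1 \<inter> path_image J \<subseteq> path_image k1" using BA(1) PF(3) k2(2) unfolding J(3) by blast
      moreover have "P1 \<inter> path_image J \<subseteq> path_image k1"
        using APk(1,2) P12 k2(2) unfolding J(3) by blast
      ultimately show ?thesis using g1(2) by blast
    qed
    show "path_image g2 \<inter> path_image J \<subseteq> path_image k2"
    proof -
      have "path_image \<beta>2 \<inter> path_image J \<subseteq> path_image k2" using BA(2) PF(4) k1(2) unfolding J(3) by blast
      moreover have "P2 \<inter> path_image J \<subseteq> path_image k2"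
        using APk(3,4) P12 k1(2) unfolding J(3) by blast
      ultimately show ?thesis using g2(2) by blast
    qed
    show "pathfinish g1 \<in> path_image k1" "pathfinish g2 \<in> path_image k2" using g1 g2 kends by auto
    show "Y \<inter> (path_image g1 \<union> path_image g2) = {}" using g1(2) g2(2) YB YF PF(1,2) by blast
    show "\<tau>1 s1 \<in> closure Y" "\<tau>2 s2 \<in> closure Y"
      using \<tau>1(12) \<tau>2(12) closure_mono[of Y1 Y] closure_mono[of Y2 Y] by (auto simp: Y_def)
    show "\<tau>1 s1 \<notin> path_image k1 \<union> path_image k2 \<union> path_image g1 \<union> path_image g2"
         "\<tau>2 s2 \<notin> path_image k1 \<union> path_image k2 \<union> path_image g1 \<union> path_image g2"
    proof -
      have "path_image k1 \<union> path_image k2 \<union> path_image g1 \<union> path_image g2 \<subseteq> P1 \<union> P2 \<union> (path_image \<beta>1 \<union> path_image \<beta>2)"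
        using k1(2) k2(2) g1(2) g2(2) by blast
      moreover have "\<tau>1 s1 \<notin> P1 \<union> P2 \<union> (path_image \<beta>1 \<union> path_image \<beta>2)"
         "\<tau>2 s2 \<notin> P1 \<union> P2 \<union> (path_image \<beta>1 \<union> path_image \<beta>2)"
        using sF PF(1,2) BA(1,2) mA(3,6) by blast+
      ultimately show "\<tau>1 s1 \<notin> path_image k1 \<union> path_image k2 \<union> path_image g1 \<union> path_image g2"
         "\<tau>2 s2 \<notin> path_image k1 \<union> path_image k2 \<union> path_image g1 \<union> path_image g2" by blast+
    qed
    show "a33 \<in> Y" using acc3 by (simp add: Y_def)
    \<comment> \<open>The ninth edge, \<open>\<beta>3\<close>, puts both chords on the same side of
      \<open>J\<close>.\<close>
    have "connected (path_image \<beta>3 \<union> Y)"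
      using conY \<beta>3(1) ends\<beta>(6) \<open>a33 \<in> Y\<close> by (intro connected_Un connected_path_image) auto
    moreover have "path_image \<beta>3 \<subseteq> F" unfolding F_def by blast
    then have "(path_image \<beta>3 \<union> Y) \<subseteq> - path_image J"
      using YJ BA(3) PF(1,2) k1(2) k2(2) unfolding J(3) by blast
    ultimately show "connected_component (- path_image J) c3 a33"
      using ends\<beta>(3) \<open>a33 \<in> Y\<close> unfolding connected_component_def by blast
  qed (use A12 g1 g2 conY YJ mA in auto)
qed

subsection \<open>Components of the complement near a locally connected set\<close>

lemma locally_connected_neighbourhood:
  fixes X :: "'a::euclidean_space set"
  assumes "locally connected X" "closed X" "x \<in> X" "e > 0"
  obtains N d where "d > 0" "compact N" "connected N" "N \<subseteq> X" "N \<subseteq> cball x e" "X \<inter> ball x d \<subseteq> N"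
proof -
  have "openin (top_of_set X) (X \<inter> ball x e)" by (simp add: openin_open_Int)
  moreover have "x \<in> X \<inter> ball x e" using assms by simp
  ultimately obtain u v where uv: "openin (top_of_set X) u" "connected v" "x \<in> u" "u \<subseteq> v" "v \<subseteq> X \<inter> ball x e"
    using assms(1) unfolding locally_def by metis
  obtain d where d: "d > 0" "ball x d \<inter> X \<subseteq> u"
    using uv(1,3) openin_contains_ball by metis
  have v: "closure v \<subseteq> X" "closure v \<subseteq> cball x e"
    by (rule closure_minimal; use uv(5) assms(2) ball_subset_cball in blast)+
  then have "compact (closure v)"
    using bounded_subset[OF bounded_cball v(2)] by (simp add: compact_eq_bounded_closed)
  then show ?thesis
    using that[OF d(1) _ connected_imp_connected_closure[OF uv(2)] v] d(2) uv(4) closure_subset[of v]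
    by (simp add: Int_commute)
qed

text \<open>A closure point of \<open>V\<close> lies in \<open>T\<close>, hence in \<open>B\<close>,
  so outside \<open>X\<close> it could be added to \<open>V\<close>; thus \<open>V\<close> cannot
  grow within \<open>- X\<close>. The use is contrapositive: when no component of \<open>- X\<close>
  fits in \<open>B\<close>, \<open>V\<close> has to leave \<open>T\<close>.\<close>

lemma component_in_closed_subset:
  fixes X B :: "'a::real_normed_vector set"
  assumes "closed X" "open B" "V \<in> components (B - X)" "closed T" "T \<subseteq> B" "V \<subseteq> T"
  shows "V \<in> components (- X)"
proof -
  have op: "open V" using assms by (meson open_Diff open_components)
  have V: "V \<noteq> {}" "V \<subseteq> B - X" "connected V"
    using assms(3) in_components_nonempty in_components_subset in_components_connected by blast+
  have "D = V" if D: "V \<subseteq> D" "D \<subseteq> - X" "connected D" for D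
  proof (rule ccontr)
    assume "D \<noteq> V"
    then have "D \<inter> frontier V \<noteq> {}"
      using D V by (intro connected_Int_frontier) auto
    then obtain z where z: "z \<in> D" "z \<in> closure V" "z \<notin> V"
      using op by (auto simp: frontier_def interior_open)
    have "closure V \<subseteq> T" using assms closure_minimal by blast
    then have "insert z V \<subseteq> B - X" using z D V assms by blast
    then have "insert z V \<subseteq> V"
      using in_closure_imp_connected_insert[OF V(3) z(2)] V(1)
      by (intro components_maximal[OF assms(3)]) auto
    then show False using z by blast
  qed
  then show ?thesis unfolding in_components_maximal using V by blast
qed

text \<open>The first point of \<open>X\<close> on the segment from \<open>q\<close> to
  \<open>u\<close> is reached from within \<open>V\<close>. It is only near \<open>u\<close>, which
  suffices when \<open>X\<close> near \<open>u\<close> lies in a small continuum.\<close>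

lemma accessible_near_point:
  fixes X B :: "'a::euclidean_space set"
  assumes "closed X" "open B" "V \<in> components (B - X)" "q \<in> V" "q \<in> ball u d" "ball u d \<subseteq> B" "u \<in> X"
  obtains a where "a \<in> X \<inter> ball u d" "path_connected (insert a V)"
proof -
  have V: "V \<subseteq> B - X" "connected V" "open V"
    using assms in_components_subset in_components_connected open_components open_Diff by (blast, blast, metis)
  let ?g = "linepath q u"
  have cg: "continuous_on {0..1} ?g" by (rule continuous_on_linepath)
  have "?g 1 \<in> X" using assms by (simp add: linepath_1')
  then obtain s where s: "s \<in> {0..1}" "?g s \<in> X" "\<And>t. \<lbrakk>0 \<le> t; t < s\<rbrakk> \<Longrightarrow> ?g t \<notin> X"
    using first_hit[OF cg assms(1)] by auto
  have gb: "?g t \<in> ball u d" if "t \<in> {0..1}" for t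
  proof -
    have "?g t \<in> closed_segment q u" using that linepath_in_path by blast
    moreover have "u \<in> ball u d" using assms(5) by (simp add: order_le_less_trans[OF zero_le_dist])
    ultimately show ?thesis using assms(5) convex_ball[of u d] closed_segment_subset by blast
  qed
  have "s \<noteq> 0" using s(2) assms(4) V by (auto simp: linepath_def)
  then have s0: "0 < s" using s by auto
  have "?g ` {0..<s} \<subseteq> V"
  proof (rule components_maximal[OF assms(3)])
    show "connected (?g ` {0..<s})"
      by (intro connected_continuous_image) auto
    show "?g ` {0..<s} \<subseteq> B - X" using s gb assms(6) by force
    have "?g 0 \<in> ?g ` {0..<s}" using s0 by (intro imageI) auto
    then show "V \<inter> ?g ` {0..<s} \<noteq> {}" using assms(4) by (auto simp: linepath_0')
  qed
  moreover have "{0..s} = insert s {0..<s}" using s0 by auto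
  ultimately have gV: "insert (?g s) V = V \<union> ?g ` {0..s}" by auto
  have "path_connected (V \<union> ?g ` {0..s})"
  proof (rule path_connected_Un)
    show "path_connected V" using V connected_open_path_connected by blast
    show "path_connected (?g ` {0..s})"
      by (rule path_connected_continuous_image) (auto simp: convex_imp_path_connected)
    have "?g 0 \<in> ?g ` {0..s}" using s0 by (intro imageI) auto
    then show "V \<inter> ?g ` {0..s} \<noteq> {}" using assms(4) by (auto simp: linepath_0')
  qed
  then show ?thesis using that[of "?g s"] gV s gb by auto
qed

text \<open>
  Infinitely many of these components would accumulate at three points \<open>u\<close>, \<open>v\<close>, \<open>w\<close> of
  \<open>X\<close> at different distances from \<open>C\<close>; three of them and small connected neighbourhoods of
  \<open>u\<close>, \<open>v\<close>, \<open>w\<close> in \<open>X\<close> would then be joined to each other like the vertices of \<open>K\<^sub>3\<^sub>,\<^sub>3\<close>.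
\<close>

lemma finite_components_meeting_compact:
  fixes X :: "complex set"
  assumes X: "closed X" "locally connected X" and "open B"
    and noB: "\<And>U. U \<in> components (- X) \<Longrightarrow> \<not> U \<subseteq> B"
    and C: "compact C" "C \<subseteq> B"
  shows "finite {V \<in> components (B - X). V \<inter> C \<noteq> {}}"
proof (rule ccontr)
  let ?VV = "{V \<in> components (B - X). V \<inter> C \<noteq> {}}"
  assume inf: "infinite ?VV"
  then have "C \<noteq> {}" by force
  obtain e where e: "e > 0" "(\<Union>x\<in>C. cball x e) \<subseteq> B"
    using compact_subset_open_imp_cball_epsilon_subset[OF C(1) \<open>open B\<close> C(2)] by blast
  define T where "T = {z. infdist z C \<le> e}"
  have T: "compact T" using compact_infdist_le[OF \<open>C \<noteq> {}\<close> C(1) e(1)] by (simp add: T_def)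
  have TB: "T \<subseteq> B"
  proof
    fix z assume "z \<in> T"
    obtain x where "x \<in> C" "infdist z C = dist z x"
      using infdist_attains_inf[OF compact_imp_closed[OF C(1)] \<open>C \<noteq> {}\<close>] by metis
    with \<open>z \<in> T\<close> e show "z \<in> B" by (force simp: T_def dist_commute)
  qed
  \<comment> \<open>\<open>V\<close> meets \<open>C\<close> and leaves \<open>T\<close>, so by
    connectedness it has points at every distance from 0 to \<open>e\<close> from
    \<open>C\<close>.\<close>
  have level: "\<exists>z\<in>V. infdist z C = s" if V: "V \<in> ?VV" and s: "0 \<le> s" "s \<le> e" for V s
  proof -
    have "\<not> V \<subseteq> T"
      using component_in_closed_subset[OF X(1) \<open>open B\<close> _ compact_imp_closed[OF T] TB] V noB TB by (metis (mono_tags, lifting) mem_Collect_eq order_trans)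
    then obtain z where "z \<in> V" "z \<notin> T" by blast
    then have z: "z \<in> V" "e < infdist z C" by (auto simp: T_def)
    obtain y where y: "y \<in> V" "y \<in> C" using V by auto
    have "connected ((\<lambda>z. infdist z C) ` V)"
      using V in_components_connected by (intro connected_continuous_image continuous_intros) auto
    moreover have "infdist y C \<le> s" "s \<le> infdist z C" using y z s by auto
    ultimately have "s \<in> (\<lambda>z. infdist z C) ` V"
      using y z unfolding connected_iff_interval by blast
    then show ?thesis by auto
  qed
  obtain f :: "nat \<Rightarrow> complex set" where f: "inj f" "range f \<subseteq> ?VV"
    using infinite_countable_subset[OF inf] by blast
  have fV: "f n \<in> components (B - X)" for n using f by auto
  define p where "p n s = (SOME z. z \<in> f n \<and> infdist z C = s)" for n s
  have p: "p n s \<in> f n \<and> infdist (p n s) C = s" if "0 \<le> s" "s \<le> e" for n s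
    unfolding p_def
  proof (rule someI_ex)
    show "\<exists>z. z \<in> f n \<and> infdist z C = s" using level[OF _ that, of "f n"] f(2) by blast
  qed
  \<comment> \<open>Three levels for three vertices, taken as a triple so that one subsequence
    converges at all of them.\<close>
  define q where "q n = (p n 0, p n (e/2), p n e)" for n
  have "\<forall>n. q n \<in> T \<times> T \<times> T" using p e by (auto simp: q_def T_def)
  moreover have "compact (T \<times> T \<times> T)" using T by (intro compact_Times)
  ultimately obtain l r where lr: "strict_mono (r :: nat \<Rightarrow> nat)" "(q \<circ> r) \<longlonglongrightarrow> l"
    unfolding compact_def by metis
  obtain u v w where l: "l = (u, v, w)" by (cases l) auto
  have lim: "(\<lambda>n. p (r n) 0) \<longlonglongrightarrow> u" "(\<lambda>n. p (r n) (e/2)) \<longlonglongrightarrow> v" "(\<lambda>n. p (r n) e) \<longlonglongrightarrow> w"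
    using tendsto_fst[OF lr(2)] tendsto_fst[OF tendsto_snd[OF lr(2)]] tendsto_snd[OF tendsto_snd[OF lr(2)]]
    by (simp_all add: l q_def o_def)
  have limpt: "infdist z C = s \<and> z \<in> X" if s: "0 \<le> s" "s \<le> e" and z: "(\<lambda>n. p (r n) s) \<longlonglongrightarrow> z" for z s
  proof -
    have "(\<lambda>n. infdist (p (r n) s) C) \<longlonglongrightarrow> infdist z C" by (intro tendsto_infdist z)
    moreover have "(\<lambda>n. infdist (p (r n) s) C) = (\<lambda>n. s)" using p[OF s] by auto
    ultimately have id: "infdist z C = s" by (simp add: LIMSEQ_const_iff)
    then have zB: "z \<in> B" using TB s by (auto simp: T_def)
    \<comment> \<open>Otherwise a disc around \<open>z\<close> off \<open>X\<close> would be
      contained in two different components of the sequence.\<close>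
    have "z \<in> X"
    proof (rule ccontr)
      assume "z \<notin> X"
      then obtain d where d: "d > 0" "ball z d \<subseteq> B - X"
        using zB openE[OF open_Diff[OF \<open>open B\<close> X(1)]] by (metis DiffI)
      have "\<forall>\<^sub>F n in sequentially. p (r n) s \<in> ball z d"
        using z d(1) by (simp add: tendsto_iff dist_commute)
      then obtain M where M: "\<And>n. n \<ge> M \<Longrightarrow> p (r n) s \<in> ball z d"
        unfolding eventually_sequentially by blast
      have "ball z d \<subseteq> f (r n)" if "n \<ge> M" for n
        using M[OF that] p[OF s, of "r n"] d by (intro components_maximal[OF fV]) auto
      then have "ball z d \<subseteq> f (r M)" "ball z d \<subseteq> f (r (Suc M))" by simp_all
      moreover have "z \<in> ball z d" using d(1) by simp
      ultimately have "f (r M) \<inter> f (r (Suc M)) \<noteq> {}" by blast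
      then have "f (r M) = f (r (Suc M))" using components_eq[OF fV fV] by blast
      then have "r M = r (Suc M)" using f(1) by (simp add: inj_eq)
      then show False using lr(1) by (metis n_not_Suc_n strict_mono_eq)
    qed
    with id show ?thesis by simp
  qed
  have u: "infdist u C = 0" "u \<in> X" and v: "infdist v C = e/2" "v \<in> X" and w: "infdist w C = e" "w \<in> X"
    using limpt[OF _ _ lim(1)] limpt[OF _ _ lim(2)] limpt[OF _ _ lim(3)] e by auto
  have ne: "u \<noteq> v" "u \<noteq> w" "v \<noteq> w" using u v w e by auto
  define \<rho> where "\<rho> = Min {dist u v, dist u w, dist v w} / 3"
  have \<rho>: "\<rho> > 0" "2 * \<rho> < dist u v" "2 * \<rho> < dist u w" "2 * \<rho> < dist v w"
  proof -
    have "0 < Min {dist u v, dist u w, dist v w}" using ne by simp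
    then show "\<rho> > 0" by (simp add: \<rho>_def)
    moreover have "3 * \<rho> \<le> dist u v" "3 * \<rho> \<le> dist u w" "3 * \<rho> \<le> dist v w"
      by (simp_all add: \<rho>_def)
    ultimately show "2 * \<rho> < dist u v" "2 * \<rho> < dist u w" "2 * \<rho> < dist v w" by linarith+
  qed
  have nb: "\<exists>N d. d > 0 \<and> compact N \<and> connected N \<and> N \<subseteq> X \<and> N \<subseteq> cball z \<rho> \<and> X \<inter> ball z d \<subseteq> N \<and> ball z d \<subseteq> B"
    if z: "z \<in> X" "z \<in> T" for z
  proof -
    obtain N d where N: "d > 0" "compact N" "connected N" "N \<subseteq> X" "N \<subseteq> cball z \<rho>" "X \<inter> ball z d \<subseteq> N"
      using locally_connected_neighbourhood[OF X(2,1) z(1) \<rho>(1)] by metis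
    have "z \<in> B" using z(2) TB by blast
    then obtain d' where d': "d' > 0" "ball z d' \<subseteq> B" using \<open>open B\<close> openE by blast
    have "min d d' > 0" "X \<inter> ball z (min d d') \<subseteq> N" "ball z (min d d') \<subseteq> B"
      using N(1,6) d' by (auto simp: ball_min_Int)
    with N(2-5) show ?thesis by blast
  qed
  have uvwT: "u \<in> T" "v \<in> T" "w \<in> T" using u v w e by (auto simp: T_def)
  obtain Nu du where Nu: "du > 0" "compact Nu" "connected Nu" "Nu \<subseteq> X" "Nu \<subseteq> cball u \<rho>" "X \<inter> ball u du \<subseteq> Nu" "ball u du \<subseteq> B"
    using nb[OF u(2) uvwT(1)] by blast
  obtain Nv dv where Nv: "dv > 0" "compact Nv" "connected Nv" "Nv \<subseteq> X" "Nv \<subseteq> cball v \<rho>" "X \<inter> ball v dv \<subseteq> Nv" "ball v dv \<subseteq> B"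
    using nb[OF v(2) uvwT(2)] by blast
  obtain Nw dw where Nw: "dw > 0" "compact Nw" "connected Nw" "Nw \<subseteq> X" "Nw \<subseteq> cball w \<rho>" "X \<inter> ball w dw \<subseteq> Nw" "ball w dw \<subseteq> B"
    using nb[OF w(2) uvwT(3)] by blast
  have cb: "cball a \<rho> \<inter> cball b \<rho> = {}" if "2 * \<rho> < dist a b" for a b :: complex
    using that dist_triangle_less_add by (auto simp: disjoint_iff) (smt (verit) dist_commute dist_triangle)
  have disj: "Nu \<inter> Nv = {}" "Nu \<inter> Nw = {}" "Nv \<inter> Nw = {}"
    using cb[OF \<rho>(2)] cb[OF \<rho>(3)] cb[OF \<rho>(4)] Nu(5) Nv(5) Nw(5) by blast+
  have ev: "\<forall>\<^sub>F n in sequentially. p (r n) s \<in> ball z d" if "d > 0" "(\<lambda>n. p (r n) s) \<longlonglongrightarrow> z" for s z d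
    using that by (simp add: tendsto_iff dist_commute)
  have "\<forall>\<^sub>F n in sequentially. p (r n) 0 \<in> ball u du \<and> p (r n) (e/2) \<in> ball v dv \<and> p (r n) e \<in> ball w dw"
    by (intro eventually_conj ev lim Nu Nv Nw)
  then obtain M where M: "\<And>n. n \<ge> M \<Longrightarrow> p (r n) 0 \<in> ball u du \<and> p (r n) (e/2) \<in> ball v dv \<and> p (r n) e \<in> ball w dw"
    unfolding eventually_sequentially by blast
  have acc: "(\<exists>a\<in>Nu. path_connected (insert a (f (r n)))) \<and> (\<exists>a\<in>Nv. path_connected (insert a (f (r n))))
      \<and> (\<exists>a\<in>Nw. path_connected (insert a (f (r n))))" if n: "n \<ge> M" for n
  proof -
    have pf: "p (r n) 0 \<in> f (r n)" "p (r n) (e/2) \<in> f (r n)" "p (r n) e \<in> f (r n)" using p e by auto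
    have b: "p (r n) 0 \<in> ball u du" "p (r n) (e/2) \<in> ball v dv" "p (r n) e \<in> ball w dw"
      using M[OF n] by auto
    note A = accessible_near_point[OF X(1) \<open>open B\<close> fV]
    obtain a1 where "a1 \<in> X \<inter> ball u du" "path_connected (insert a1 (f (r n)))"
      by (rule A[OF pf(1) b(1) Nu(7) u(2)])
    moreover obtain a2 where "a2 \<in> X \<inter> ball v dv" "path_connected (insert a2 (f (r n)))"
      by (rule A[OF pf(2) b(2) Nv(7) v(2)])
    moreover obtain a3 where "a3 \<in> X \<inter> ball w dw" "path_connected (insert a3 (f (r n)))"
      by (rule A[OF pf(3) b(3) Nw(7) w(2)])
    ultimately show ?thesis using Nu(6) Nv(6) Nw(6) by blast
  qed
  define V where "V i = f (r (M + i))" for i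
  have "\<exists>a\<in>Nu. path_connected (insert a (V i))" "\<exists>a\<in>Nv. path_connected (insert a (V i))"
      "\<exists>a\<in>Nw. path_connected (insert a (V i))" for i
    using acc[of "M + i"] by (simp_all add: V_def)
  then obtain a1 a2 a3 where a: "\<And>i. a1 i \<in> Nu \<and> path_connected (insert (a1 i) (V i))"
     "\<And>i. a2 i \<in> Nv \<and> path_connected (insert (a2 i) (V i))" "\<And>i. a3 i \<in> Nw \<and> path_connected (insert (a3 i) (V i))"
    by metis
  have Vdisj: "V i \<inter> V j = {}" if "i \<noteq> j" for i j
  proof -
    have "f (r (M + i)) \<noteq> f (r (M + j))"
      using that f(1) strict_mono_eq[OF lr(1)] by (auto simp: inj_eq)
    then show ?thesis using components_nonoverlap[OF fV fV] by (simp add: V_def)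
  qed
  have VX: "V i \<noteq> {}" "V i \<inter> X = {}" for i
    using in_components_nonempty[OF fV, of "r (M+i)"] in_components_subset[OF fV, of "r (M+i)"] by (auto simp: V_def)
  have NV: "(Nu \<union> Nv \<union> Nw) \<inter> (V 0 \<union> V 1 \<union> V 2) = {}" using VX(2) Nu(4) Nv(4) Nw(4) by blast
  have d: "V 0 \<inter> V 1 = {}" "V 0 \<inter> V 2 = {}" "V 1 \<inter> V 2 = {}" using Vdisj by simp_all
  show False
    by (rule no_planar_K33[OF Nu(2) Nv(2) Nw(2) Nu(3) Nv(3) Nw(3) disj d VX(1) VX(1) VX(1) NV,
          where ?a11.0 = "a1 0" and ?a12.0 = "a2 0" and ?a13.0 = "a3 0" and ?a21.0 = "a1 1" and ?a22.0 = "a2 1" and ?a23.0 = "a3 1" and ?a31.0 = "a1 2" and ?a32.0 = "a2 2" and ?a33.0 = "a3 2"]) (simp_all add: a)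
qed

section \<open>Accessibility of boundary points\<close>

text \<open>Path \<open>f n\<close> is traversed in the time from \<open>n\<close> to
  \<open>n + 1\<close>, and the half-line is compressed to \<open>{0..<1}\<close> by
  \<open>t / (1 - t)\<close>. The shrinking of the images to \<open>p\<close> gives continuity at
  1.\<close>

lemma path_through_infinitely_many:
  fixes f :: "nat \<Rightarrow> real \<Rightarrow> 'a::metric_space"
  assumes f: "\<And>k. path (f k)" "\<And>k. pathfinish (f k) = pathstart (f (Suc k))"
    and lim: "\<And>e. e > 0 \<Longrightarrow> \<exists>n. \<forall>k\<ge>n. path_image (f k) \<subseteq> ball p e"
  obtains g where "path g" "pathstart g = pathstart (f 0)" "pathfinish g = p"
    "path_image g \<subseteq> insert p (\<Union>k. path_image (f k))"
proof -
  define h where "h s = f (nat \<lfloor>s\<rfloor>) (s - real (nat \<lfloor>s\<rfloor>))" for s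
  have hn: "h s = f n (s - real n)" if "s \<in> {real n..real (Suc n)}" for s n
  proof (cases "s = real (Suc n)")
    case True
    then have "nat \<lfloor>s\<rfloor> = Suc n" by linarith
    then show ?thesis using True f(2)[of n] by (simp add: h_def pathstart_def pathfinish_def)
  next
    case False
    with that have "nat \<lfloor>s\<rfloor> = n" by (simp add: nat_eq_iff floor_eq_iff)
    then show ?thesis by (simp add: h_def)
  qed
  have c1: "continuous_on {real n..real (Suc n)} h" for n
  proof -
    have "continuous_on {0..1} (f n)" using f(1) by (simp add: path_def)
    then have "continuous_on {real n..real (Suc n)} (\<lambda>s. f n (s - real n))"
      by (rule continuous_on_compose2) (auto intro!: continuous_intros)
    then show ?thesis by (rule continuous_on_eq) (use hn in simp)
  qed
  have c2: "continuous_on {0..real n} h" for n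
  proof (induction n)
    case 0
    then show ?case by simp
  next
    case (Suc n)
    have "{0..real (Suc n)} = {0..real n} \<union> {real n..real (Suc n)}" by auto
    then show ?case using continuous_on_closed_Un[OF _ _ Suc c1[of n]] by simp
  qed
  have ch: "continuous_on {0..} h"
    unfolding continuous_on_eq_continuous_within
  proof
    fix s :: real assume s: "s \<in> {0..}"
    obtain n where n: "s < real n" using reals_Archimedean2 by blast
    have "at s within {0..} = at s within {0..real n}"
      by (rule at_within_nhd[of s "{..<real n}"]) (use n in auto)
    moreover have "continuous (at s within {0..real n}) h"
      using c2[of n] s n by (simp add: continuous_on_eq_continuous_within)
    ultimately show "continuous (at s within {0..}) h" by simp
  qed
  have him: "h s \<in> path_image (f (nat \<lfloor>s\<rfloor>))" if "s \<ge> 0" for s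
  proof -
    have "s - real (nat \<lfloor>s\<rfloor>) \<in> {0..1}" using that by auto linarith+
    then show ?thesis by (auto simp: h_def path_image_def)
  qed
  define g where "g t = (if t = 1 then p else h (t / (1 - t)))" for t :: real
  have cg': "continuous_on {0..<1} g"
  proof -
    have "continuous_on {0..<1} (\<lambda>t. h (t / (1 - t)))"
      by (rule continuous_on_compose2[OF ch]) (auto intro!: continuous_intros)
    then show ?thesis by (rule continuous_on_eq) (auto simp: g_def)
  qed
  have "continuous (at t within {0..1}) g" if t: "t \<in> {0..1}" for t
  proof (cases "t = 1")
    case False
    have "at t within {0..1} = at t within {0..<1}"
      by (rule at_within_nhd[of t "{..<1}"]) (use t False in auto)
    then show ?thesis using cg' t False by (simp add: continuous_on_eq_continuous_within)
  next
    case True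
    have "(g \<longlongrightarrow> p) (at 1 within {0..1})"
    proof (rule tendstoI)
      fix e :: real assume "e > 0"
      then obtain n where n: "\<And>k. k \<ge> n \<Longrightarrow> path_image (f k) \<subseteq> ball p e" using lim by blast
      \<comment> \<open>Within \<open>1 / (real n + 1)\<close> of the end the paths with index below
        \<open>n\<close> are over.\<close>
      have "dist (g t) p < e" if t: "t \<in> {0..1}" "t \<noteq> 1" "dist t 1 < 1 / (real n + 1)" for t
      proof -
        have t1: "0 < 1 - t" "1 - t < 1 / (real n + 1)" using t by (auto simp: dist_real_def)
        then have "real n + 1 < 1 / (1 - t)"
          by (simp add: field_simps)
        moreover have "t / (1 - t) = 1 / (1 - t) - 1" using t1 by (simp add: field_simps)
        ultimately have ge: "t / (1 - t) \<ge> real n" by simp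
        then have "nat \<lfloor>t / (1 - t)\<rfloor> \<ge> n" by (simp add: le_nat_floor)
        then have "h (t / (1 - t)) \<in> ball p e" using him[of "t / (1 - t)"] n ge by force
        then show ?thesis using t by (simp add: g_def dist_commute)
      qed
      then show "\<forall>\<^sub>F t in at 1 within {0..1}. dist (g t) p < e"
        unfolding eventually_at by (intro exI[of _ "1 / (real n + 1)"]) auto
    qed
    then show ?thesis using True by (simp add: continuous_within g_def)
  qed
  then have "path g" by (simp add: path_def continuous_on_eq_continuous_within)
  moreover have "pathstart g = pathstart (f 0)" by (simp add: pathstart_def g_def h_def)
  moreover have "pathfinish g = p" by (simp add: pathfinish_def g_def)
  moreover have "path_image g \<subseteq> insert p (\<Union>k. path_image (f k))"
  proof -
    have "g t \<in> insert p (\<Union>k. path_image (f k))" if "t \<in> {0..1}" for t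
      using him[of "t / (1 - t)"] that by (auto simp: g_def)
    then show ?thesis unfolding path_image_def[of g] by blast
  qed
  ultimately show ?thesis using that by blast
qed

text \<open>Only finitely many components of \<open>B' - X\<close> come near \<open>p\<close>. The
  closure of their union is therefore the union of their closures, and one of those inside
  \<open>W\<close> already accumulates at \<open>p\<close>.\<close>

lemma component_adherent_refine:
  fixes X :: "complex set"
  assumes X: "closed X" "locally connected X" and "open B'" "B' \<subseteq> B" "p \<in> B'"
    and noB: "\<And>U. U \<in> components (- X) \<Longrightarrow> \<not> U \<subseteq> B"
    and W: "W \<in> components (B - X)" "p \<in> closure W"
  obtains W' where "W' \<in> components (B' - X)" "W' \<subseteq> W" "p \<in> closure W'"
proof -
  obtain e where e: "e > 0" "cball p e \<subseteq> B'" using assms(3,5) open_contains_cball by blast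
  define FF where "FF = {V \<in> components (B' - X). V \<inter> cball p e \<noteq> {} \<and> V \<subseteq> W}"
  have "finite {V \<in> components (B' - X). V \<inter> cball p e \<noteq> {}}"
    by (rule finite_components_meeting_compact[OF X \<open>open B'\<close>]) (use noB \<open>B' \<subseteq> B\<close> e in auto)
  then have fin: "finite FF" by (rule rev_finite_subset) (auto simp: FF_def)
  have "W \<inter> ball p e \<subseteq> \<Union>FF"
  proof
    fix z assume z: "z \<in> W \<inter> ball p e"
    have WB: "W \<subseteq> B - X" using W(1) in_components_subset by blast
    have "z \<in> B' - X" using z e WB ball_subset_cball[of p e] by blast
    then obtain V where V: "V \<in> components (B' - X)" "z \<in> V" by (metis UnionE Union_components)
    have "V \<subseteq> W"
      using V z \<open>B' \<subseteq> B\<close> in_components_subset[OF V(1)] in_components_connected[OF V(1)]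
      by (intro components_maximal[OF W(1)]) auto
    moreover have "V \<inter> cball p e \<noteq> {}" using z V ball_subset_cball[of p e] by blast
    ultimately have "V \<in> FF" using V by (simp add: FF_def)
    then show "z \<in> \<Union>FF" using V by blast
  qed
  also have "\<Union>FF \<subseteq> (\<Union>V\<in>FF. closure V)" using closure_subset by fast
  finally have "closure (W \<inter> ball p e) \<subseteq> (\<Union>V\<in>FF. closure V)"
    by (rule closure_minimal) (use fin in auto)
  moreover have "p \<in> closure (W \<inter> ball p e)"
    using W(2) open_Int_closure_subset[of "ball p e" W] e(1) by (auto simp: Int_commute)
  ultimately obtain V where "V \<in> FF" "p \<in> closure V" by blast
  then show ?thesis using that by (auto simp: FF_def)
qed

text \<open>In discs shrinking to \<open>p\<close>, nested components adherent to \<open>p\<close>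
  are chosen by repeated refinement. Points picked in consecutive ones are joined inside the larger
  of the two, and the concatenation of these paths converges to \<open>p\<close>.\<close>

lemma accessible_boundary_point:
  fixes X :: "complex set"
  assumes X: "closed X" "locally connected X" and "open B" "p \<in> B"
    and noB: "\<And>U. U \<in> components (- X) \<Longrightarrow> \<not> U \<subseteq> B"
    and V: "V \<in> components (B - X)" "p \<in> closure V"
  shows "path_connected (insert p V)"
proof -
  obtain e where e: "e > 0" "ball p e \<subseteq> B" using \<open>open B\<close> \<open>p \<in> B\<close> openE by blast
  define b where "b k = ball p (e / real (Suc k))" for k
  have bB: "b k \<subseteq> B" for k
  proof -
    have "e / real (Suc k) \<le> e" using e(1) by (simp add: field_simps)
    then have "b k \<subseteq> ball p e" unfolding b_def by (rule subset_ball)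
    then show ?thesis using e by blast
  qed
  have bS: "b (Suc k) \<subseteq> b k" for k
  proof -
    have "e / real (Suc (Suc k)) \<le> e / real (Suc k)" using e(1) by (intro divide_left_mono) auto
    then show ?thesis unfolding b_def by (rule subset_ball)
  qed
  have bp: "p \<in> b k" "open (b k)" for k using e(1) by (auto simp: b_def)
  have nob: "\<not> U \<subseteq> b k" if "U \<in> components (- X)" for U k using noB[OF that] bB by blast
  define P where "P k W \<longleftrightarrow> W \<in> components (b k - X) \<and> W \<subseteq> V \<and> p \<in> closure W" for k W
  have "\<exists>W. \<forall>k. P k (W k) \<and> W (Suc k) \<subseteq> W k"
  proof (rule dependent_nat_choice)
    show "\<exists>W. P 0 W"
      using component_adherent_refine[OF X bp(2) bB bp(1) noB V] unfolding P_def by metis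
    show "\<exists>W'. P (Suc k) W' \<and> W' \<subseteq> W" if "P k W" for W k
      using component_adherent_refine[OF X bp(2) bS bp(1) nob, of W] that unfolding P_def by (metis order_trans)
  qed
  then obtain W where W: "\<And>k. P k (W k)" "\<And>k. W (Suc k) \<subseteq> W k" by blast
  have Wk: "W k \<noteq> {}" "W k \<subseteq> b k - X" "path_connected (W k)" "W k \<subseteq> V" for k
  proof -
    have c: "W k \<in> components (b k - X)" using W by (simp add: P_def)
    then show "W k \<noteq> {}" "W k \<subseteq> b k - X" using in_components_nonempty in_components_subset by blast+
    show "path_connected (W k)"
      using c bp(2) X(1) by (meson connected_open_path_connected in_components_connected open_Diff open_components)
    show "W k \<subseteq> V" using W by (simp add: P_def)
  qed
  have "\<exists>x. x \<in> W k" for k using Wk(1)[of k] by blast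
  then obtain z where z: "\<And>k. z k \<in> W k" by metis
  have "\<exists>f. path f \<and> path_image f \<subseteq> W k \<and> pathstart f = z k \<and> pathfinish f = z (Suc k)" for k
    using Wk(3)[of k] z[of k] z[of "Suc k"] W(2)[of k] unfolding path_connected_def by blast
  then obtain f where f: "\<And>k. path (f k)" "\<And>k. path_image (f k) \<subseteq> W k" "\<And>k. pathstart (f k) = z k"
      "\<And>k. pathfinish (f k) = z (Suc k)" by metis
  have "\<exists>n. \<forall>k\<ge>n. path_image (f k) \<subseteq> ball p d" if "d > 0" for d
  proof -
    obtain n where "e / d < real n" using reals_Archimedean2 by blast
    then have "e / real (Suc k) \<le> d" if "k \<ge> n" for k
      using that \<open>d > 0\<close> by (simp add: field_simps) (smt (verit) mult_left_mono of_nat_mono)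
    then have "b k \<subseteq> ball p d" if "k \<ge> n" for k using that unfolding b_def by (intro subset_ball) auto
    then show ?thesis using f(2) Wk(2) by (intro exI[of _ n]) blast
  qed
  then obtain g where g: "path g" "pathstart g = z 0" "pathfinish g = p" "path_image g \<subseteq> insert p (\<Union>k. path_image (f k))"
    using path_through_infinitely_many[of f p] f by metis
  have gV: "path_image g \<subseteq> insert p V" using g(4) f(2) Wk(4) by blast
  have "p \<in> path_image g" "z 0 \<in> path_image g" using g pathstart_in_path_image pathfinish_in_path_image by metis+
  then have "insert p V = V \<union> path_image g" "V \<inter> path_image g \<noteq> {}" using gV z[of 0] Wk(4)[of 0] by blast+
  moreover have "path_connected V"
    using V(1) \<open>open B\<close> X(1) by (meson connected_open_path_connected in_components_connected open_Diff open_components)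
  ultimately show ?thesis using g(1) by (simp add: path_connected_Un path_connected_path_image)
qed

subsection \<open>Paths meeting the boundary in finitely many points\<close>

text \<open>\<open>K\<close> is a parameter because in logarithmic coordinates the frontier is
  replaced by its preimage under the exponential.\<close>

definition finitely_joined :: "'a::topological_space set \<Rightarrow> 'a set \<Rightarrow> 'a \<Rightarrow> 'a \<Rightarrow> bool" where
  "finitely_joined K S a b \<longleftrightarrow>
     (\<exists>g. path g \<and> path_image g \<subseteq> S \<and> pathstart g = a \<and> pathfinish g = b \<and> finite (path_image g \<inter> K))"

lemma finitely_joined_sym: "finitely_joined K S a b \<Longrightarrow> finitely_joined K S b a"
  unfolding finitely_joined_def
  by (metis path_image_reversepath path_reversepath pathfinish_reversepath pathstart_reversepath)

lemma finitely_joined_trans: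
  assumes "finitely_joined K S a b" "finitely_joined K S b c"
  shows "finitely_joined K S a c"
proof -
  obtain g where g: "path g" "path_image g \<subseteq> S" "pathstart g = a" "pathfinish g = b" "finite (path_image g \<inter> K)"
    using assms(1) unfolding finitely_joined_def by blast
  obtain h where h: "path h" "path_image h \<subseteq> S" "pathstart h = b" "pathfinish h = c" "finite (path_image h \<inter> K)"
    using assms(2) unfolding finitely_joined_def by blast
  have "path_image (g +++ h) \<inter> K = (path_image g \<inter> K) \<union> (path_image h \<inter> K)"
    using g h by (auto simp: path_image_join)
  then show ?thesis
    unfolding finitely_joined_def using g h by (intro exI[of _ "g +++ h"]) (auto simp: path_image_join)
qed

text \<open>
  All passages of the path through the closure of a component \<open>V\<close> are replaced by a single
  one, which stays in \<open>V\<close> between two accessible boundary points.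
\<close>

lemma finitely_joined_if_frontier_covered:
  fixes X :: "complex set"
  assumes X: "closed X" "locally connected X" and B: "open B"
    and noB: "\<And>U. U \<in> components (- X) \<Longrightarrow> \<not> U \<subseteq> B"
    and "finite VV" "VV \<subseteq> components (B - X)" "finite F" "path g" "path_image g \<subseteq> B"
      "path_image g \<inter> frontier X \<subseteq> F \<union> \<Union> (closure ` VV)"
  shows "finitely_joined (frontier X) B (pathstart g) (pathfinish g)"
  using assms(5-)
proof (induction VV arbitrary: g F rule: finite_induct)
  case empty
  then have "finite (path_image g \<inter> frontier X)" by (auto intro: finite_subset)
  with empty show ?case unfolding finitely_joined_def by blast
next
  case (insert V VV)
  have VV: "VV \<subseteq> components (B - X)" and V: "V \<in> components (B - X)" using insert.prems by auto
  show ?case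
  proof (cases "path_image g \<inter> closure V = {}")
    case True
    then have "path_image g \<inter> frontier X \<subseteq> F \<union> \<Union> (closure ` VV)" using insert.prems by blast
    then show ?thesis using insert.IH[OF VV] insert.prems by blast
  next
    case False
    then obtain s where s: "s \<in> {0..1}" "g s \<in> closure V" unfolding path_image_def by blast
    have cg: "continuous_on {0..1} g" using insert.prems by (simp add: path_def)
    have cg': "continuous_on {0..s} g" "continuous_on {s..1} g"
      by (rule continuous_on_subset[OF cg]; use s in auto)+
    obtain t0 where t0: "t0 \<in> {0..s}" "g t0 \<in> closure V" "\<And>t. \<lbrakk>0 \<le> t; t < t0\<rbrakk> \<Longrightarrow> g t \<notin> closure V"
      using first_hit[OF cg'(1) closed_closure _ s(2)] s(1) by auto
    obtain t1 where t1: "t1 \<in> {s..1}" "g t1 \<in> closure V" "\<And>t. \<lbrakk>t1 < t; t \<le> 1\<rbrakk> \<Longrightarrow> g t \<notin> closure V"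
      using last_hit[OF cg'(2) closed_closure _ s(2)] s(1) by auto
    have t01: "t0 \<in> {0..1}" "t1 \<in> {0..1}" using t0 t1 s by auto
    have gB: "g t0 \<in> B" "g t1 \<in> B" using t01 insert.prems by (auto simp: path_image_def)
    have im: "path_image (subpath 0 t0 g) = g ` {0..t0}" "path_image (subpath t1 1 g) = g ` {t1..1}"
      using t01 by (auto simp: path_image_subpath)
    have sub: "g ` {0..t0} \<subseteq> path_image g" "g ` {t1..1} \<subseteq> path_image g"
      using t01 by (auto simp: path_image_def)
    have off: "g ` {0..t0} \<inter> closure V \<subseteq> {g t0}" "g ` {t1..1} \<inter> closure V \<subseteq> {g t1}"
      using t0(3) t1(3) by (auto simp: le_less)
    \<comment> \<open>Up to \<open>t0\<close> the path meets \<open>closure V\<close> at most in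
      \<open>g t0\<close>. That point joins the finite exceptional set, and \<open>V\<close> drops
      out of the induction.\<close>
    have "finitely_joined (frontier X) B (pathstart (subpath 0 t0 g)) (pathfinish (subpath 0 t0 g))"
    proof (rule insert.IH[OF VV])
      show "finite (F \<union> {g t0})" using insert.prems by simp
      show "path (subpath 0 t0 g)" using insert.prems t01 by simp
      show "path_image (subpath 0 t0 g) \<subseteq> B" using im sub insert.prems by auto
      show "path_image (subpath 0 t0 g) \<inter> frontier X \<subseteq> F \<union> {g t0} \<union> \<Union> (closure ` VV)"
        using im(1) sub(1) off(1) insert.prems(5) by auto
    qed
    moreover have "finitely_joined (frontier X) B (pathstart (subpath t1 1 g)) (pathfinish (subpath t1 1 g))"
    proof (rule insert.IH[OF VV])
      show "finite (F \<union> {g t1})" using insert.prems by simp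
      show "path (subpath t1 1 g)" using insert.prems t01 by simp
      show "path_image (subpath t1 1 g) \<subseteq> B" using im sub insert.prems by auto
      show "path_image (subpath t1 1 g) \<inter> frontier X \<subseteq> F \<union> {g t1} \<union> \<Union> (closure ` VV)"
        using im(2) sub(2) off(2) insert.prems(5) by auto
    qed
    moreover have "finitely_joined (frontier X) B (g t0) (g t1)"
    proof -
      have "path_connected (insert (g t0) V)" "path_connected (insert (g t1) V)"
        using accessible_boundary_point[OF X B _ noB V] gB t0 t1 by auto
      moreover have "V \<noteq> {}" using in_components_nonempty[OF V] .
      ultimately have "path_connected (insert (g t0) V \<union> insert (g t1) V)"
        by (intro path_connected_Un) auto
      then obtain h where h: "path h" "path_image h \<subseteq> insert (g t0) V \<union> insert (g t1) V"
          "pathstart h = g t0" "pathfinish h = g t1"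
        unfolding path_connected_def by blast
      have VB: "V \<subseteq> B - X" using in_components_subset[OF V] .
      have "frontier X \<subseteq> X" using X(1) by (simp add: frontier_subset_closed)
      then have "path_image h \<inter> frontier X \<subseteq> {g t0, g t1}" using h(2) VB by blast
      moreover have "path_image h \<subseteq> B" using h(2) VB gB by blast
      ultimately show ?thesis unfolding finitely_joined_def
        using h by (intro exI[of _ h]) (auto intro: finite_subset)
    qed
    ultimately show ?thesis
      by (metis finitely_joined_trans pathfinish_def pathfinish_subpath pathstart_def pathstart_subpath)
  qed
qed

text \<open>The segment stays in the half disc. A frontier point there is a limit of points of the
  half disc off \<open>X\<close>, and these lie in finitely many components of the full disc minus
  \<open>X\<close>, so finitely many closures cover it.\<close>

lemma finitely_joined_in_ball:
  fixes X :: "complex set"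
  assumes X: "closed X" "locally connected X"
    and noB: "\<And>U. U \<in> components (- X) \<Longrightarrow> \<not> U \<subseteq> ball c e"
    and a: "a \<in> ball c (e/2)"
  shows "finitely_joined (frontier X) (ball c e) c a"
proof -
  have e: "e > 0" using a by (smt (verit) half_gt_zero_iff mem_ball zero_le_dist)
  define VV where "VV = {V \<in> components (ball c e - X). V \<inter> cball c (e/2) \<noteq> {}}"
  have "cball c (e/2) \<subseteq> ball c e" using e by auto
  then have fin: "finite VV" unfolding VV_def
    by (intro finite_components_meeting_compact[OF X _ noB]) auto
  have seg: "closed_segment c a \<subseteq> ball c (e/2)"
    using a e by (intro closed_segment_subset) auto
  have "ball c (e/2) \<inter> - X \<subseteq> \<Union>VV"
  proof
    fix z assume z: "z \<in> ball c (e/2) \<inter> - X"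
    then have "z \<in> ball c e - X" using e by auto
    then obtain V where V: "V \<in> components (ball c e - X)" "z \<in> V" by (metis UnionE Union_components)
    moreover have "V \<inter> cball c (e/2) \<noteq> {}" using V(2) z ball_subset_cball by blast
    ultimately show "z \<in> \<Union>VV" by (auto simp: VV_def)
  qed
  also have "\<Union>VV \<subseteq> \<Union> (closure ` VV)" using closure_subset by fast
  finally have "closure (ball c (e/2) \<inter> - X) \<subseteq> \<Union> (closure ` VV)"
    by (rule closure_minimal) (use fin in auto)
  moreover have "ball c (e/2) \<inter> frontier X \<subseteq> closure (ball c (e/2) \<inter> - X)"
    using open_Int_closure_subset[of "ball c (e/2)" "- X"] by (auto simp: frontier_closures)
  ultimately have cov: "path_image (linepath c a) \<inter> frontier X \<subseteq> {} \<union> \<Union> (closure ` VV)"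
    using seg by auto
  have "path_image (linepath c a) \<subseteq> ball c e" using seg e by auto
  then have "finitely_joined (frontier X) (ball c e) (pathstart (linepath c a)) (pathfinish (linepath c a))"
    by (intro finitely_joined_if_frontier_covered[OF X open_ball noB fin _ finite.emptyI path_linepath _ cov]) 
      (auto simp: VV_def)
  then show ?thesis by simp
qed

section \<open>Loops around a point in logarithmic coordinates\<close>

lemma norm_ge_if_exp_eq:
  fixes w z :: complex
  assumes "exp w = exp z" "w \<noteq> z"
  shows "1 \<le> norm (w - z)"
proof -
  have "2 * pi \<le> \<bar>Im w - Im z\<bar>" using exp_complex_eqI[of w z] assms by argo
  also have "\<dots> \<le> norm (w - z)" using abs_Im_le_cmod[of "w - z"] by simp
  finally show ?thesis using pi_gt3 by linarith
qed

text \<open>With winding number zero there would be a continuous logarithm \<open>q\<close> with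
  equal end values. Two logarithms of one curve differ by values in a discrete set, hence by a
  constant, so \<open>\<psi>\<close> would have equal end values too.\<close>

lemma winding_number_exp_nonzero:
  assumes "path \<psi>" "\<psi> 0 \<noteq> \<psi> 1"
  shows "winding_number (\<lambda>t. z + exp (\<psi> t)) z \<noteq> 0"
proof
  let ?p = "\<lambda>t. z + exp (\<psi> t)"
  assume wn: "winding_number ?p z = 0"
  have cp: "continuous_on {0..1} \<psi>" using assms by (simp add: path_def)
  then have "path ?p" unfolding path_def by (intro continuous_intros)
  moreover have "z \<notin> path_image ?p" by (auto simp: path_image_def)
  ultimately obtain q where q: "path q" "pathfinish q - pathstart q = 2 * of_real pi * \<i> * winding_number ?p z"
      "\<And>t. t \<in> {0..1} \<Longrightarrow> ?p t = z + exp (q t)"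
    using winding_number_as_continuous_log by metis
  have "(\<lambda>t. \<psi> t - q t) constant_on {0..1}"
  proof (rule continuous_discrete_range_constant)
    show "continuous_on {0..1} (\<lambda>t. \<psi> t - q t)"
      using cp q(1) by (auto simp: path_def intro: continuous_intros)
    show "\<exists>e>0. \<forall>y. y \<in> {0..1} \<and> \<psi> y - q y \<noteq> \<psi> x - q x \<longrightarrow> e \<le> norm (\<psi> y - q y - (\<psi> x - q x))"
      if x: "x \<in> {0..1}" for x
    proof -
      have "1 \<le> norm (\<psi> y - q y - (\<psi> x - q x))" if "y \<in> {0..1}" "\<psi> y - q y \<noteq> \<psi> x - q x" for y
        using norm_ge_if_exp_eq[of "\<psi> y - q y" "\<psi> x - q x"] that x q(3) by (simp add: exp_diff)
      then show ?thesis by (intro exI[of _ 1]) auto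
    qed
  qed simp
  then obtain d where "\<And>t. t \<in> {0..1} \<Longrightarrow> \<psi> t - q t = d" unfolding constant_on_def by blast
  then have "\<psi> 0 - q 0 = \<psi> 1 - q 1" by simp
  moreover have "q 0 = q 1" using q(2) wn by (simp add: pathstart_def pathfinish_def)
  ultimately show False using assms by simp
qed

text \<open>
  Logarithmic coordinates around \<open>z\<close>. An arc between two different logarithms of the same
  point contains a shortest such sub-arc, and the exponential is injective on it except at
  its ends.
\<close>

lemma simple_loop_from_logarithmic_arc:
  assumes q: "arc q" "exp (q 0) = exp (q 1)"
  obtains J where "simple_path J" "pathfinish J = pathstart J"
    "path_image J \<subseteq> (\<lambda>w. z + exp w) ` path_image q" "winding_number J z \<noteq> 0"
proof -
  have cq: "continuous_on {0..1} q" and inj: "inj_on q {0..1}" using q by (auto simp: arc_def path_def)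
  \<comment> \<open>The condition of distinct parameters is not closed. Distinct logarithms of one
    number are at least 1 apart, so \<open>1 \<le> norm\<close> expresses it by a closed condition
    and \<open>D\<close> becomes compact.\<close>
  define D where "D = {p \<in> {0..1} \<times> {0..1}. exp (q (fst p)) = exp (q (snd p)) \<and> 1 \<le> norm (q (fst p) - q (snd p)) \<and> fst p \<le> snd p}"
  have sub: "fst ` ({0..1} \<times> {0..1}) \<subseteq> {0..1::real}" "snd ` ({0..1} \<times> {0..1}) \<subseteq> {0..1::real}" by auto
  have cf: "continuous_on ({0..1} \<times> {0..1}) (\<lambda>p. q (fst p))" "continuous_on ({0..1} \<times> {0..1}) (\<lambda>p. q (snd p))"
    by (rule continuous_on_compose2[OF cq continuous_on_fst[OF continuous_on_id] sub(1)],
        rule continuous_on_compose2[OF cq continuous_on_snd[OF continuous_on_id] sub(2)])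
  have "closed {p \<in> {0..1} \<times> {0..1}. exp (q (fst p)) = exp (q (snd p))}"
    by (intro continuous_closed_preimage_constant[of _ "\<lambda>p. exp (q (fst p)) - exp (q (snd p))" 0, simplified] closed_Times)
      (auto intro!: continuous_intros cf)
  moreover have "closed {p \<in> {0..1} \<times> {0..1}. 1 \<le> norm (q (fst p) - q (snd p))}"
    by (intro continuous_closed_preimage[of _ "\<lambda>p. norm (q (fst p) - q (snd p))" "{1..}", unfolded vimage_def Int_def, simplified] closed_Times)
      (auto intro!: continuous_intros cf)
  moreover have "closed {p. fst p \<le> (snd p :: real)}"
    by (intro closed_Collect_le continuous_intros)
  ultimately have "closed ({p \<in> {0..1} \<times> {0..1}. exp (q (fst p)) = exp (q (snd p))} \<inter>
      {p \<in> {0..1} \<times> {0..1}. 1 \<le> norm (q (fst p) - q (snd p))} \<inter> {p. fst p \<le> (snd p :: real)})" by blast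
  moreover have "D = {p \<in> {0..1} \<times> {0..1}. exp (q (fst p)) = exp (q (snd p))} \<inter>
      {p \<in> {0..1} \<times> {0..1}. 1 \<le> norm (q (fst p) - q (snd p))} \<inter> {p. fst p \<le> (snd p :: real)}"
    by (auto simp: D_def)
  moreover have "bounded D"
    by (rule bounded_subset[of "{0..1} \<times> {0..1}"]) (auto simp: D_def bounded_Times)
  ultimately have D: "compact D" by (simp add: compact_eq_bounded_closed)
  have inD: "(s, t) \<in> D" if "s \<in> {0..1}" "t \<in> {0..1}" "s < t" "exp (q s) = exp (q t)" for s t
  proof -
    have "q s \<noteq> q t" using that inj_onD[OF inj, of s t] by auto
    then show ?thesis using that norm_ge_if_exp_eq[of "q s" "q t"] by (auto simp: D_def)
  qed
  have "(0, 1) \<in> D" by (rule inD) (use q in auto)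
  then have "D \<noteq> {}" by blast
  moreover have "continuous_on D (\<lambda>p. snd p - fst p)" by (intro continuous_intros)
  ultimately obtain p where p: "p \<in> D" "\<forall>p'\<in>D. snd p - fst p \<le> snd p' - fst p'"
    using continuous_attains_inf[OF D] by blast
  obtain s t where st: "p = (s, t)" by (cases p)
  have s: "s \<in> {0..1}" "t \<in> {0..1}" "s \<le> t" "exp (q s) = exp (q t)" "q s \<noteq> q t"
    using p(1) st by (auto simp: D_def)
  then have "s < t" by (cases "s = t") auto
  have min: "t - s \<le> b - a" if "a \<in> {0..1}" "b \<in> {0..1}" "a < b" "exp (q a) = exp (q b)" for a b
    using bspec[OF p(2) inD[OF that]] st by simp
  define \<psi> where "\<psi> = subpath s t q"
  define J where "J = (\<lambda>u. z + exp (\<psi> u))"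
  have \<psi>: "path \<psi>" "\<psi> 0 = q s" "\<psi> 1 = q t" "path_image \<psi> \<subseteq> path_image q"
  proof -
    show "path \<psi>" unfolding \<psi>_def using s arc_imp_path[OF q(1)] by (intro path_subpath) auto
    show "path_image \<psi> \<subseteq> path_image q" unfolding \<psi>_def using s by (intro path_image_subpath_subset) auto
  qed (simp_all add: \<psi>_def subpath_def)
  \<comment> \<open>A coincidence of \<open>J\<close> at \<open>a\<close> and \<open>b\<close> gives
    a pair in \<open>D\<close> of length \<open>(b - a) * (t - s)\<close>, and minimality of
    \<open>t - s\<close> forces the whole interval.\<close>
  have key: "a = 0 \<and> b = 1" if "0 \<le> a" "a < b" "b \<le> 1" "J a = J b" for a b
  proof -
    have mono: "s + a * (t - s) < s + b * (t - s)" using that \<open>s < t\<close> by simp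
    have "b * (t - s) \<le> t - s" "0 \<le> a * (t - s)"
      using that \<open>s < t\<close> mult_right_mono[of b 1 "t - s"] by simp_all
    then have "s + a * (t - s) \<in> {0..1}" "s + b * (t - s) \<in> {0..1}" using s mono by auto
    then have "t - s \<le> (s + b * (t - s)) - (s + a * (t - s))"
      using that mono by (intro min) (auto simp: J_def \<psi>_def subpath_def algebra_simps)
    then have "1 * (t - s) \<le> (b - a) * (t - s)" by (simp add: algebra_simps)
    then have "1 \<le> b - a" using \<open>s < t\<close> by (simp only: mult_le_cancel_right)
    then show ?thesis using that by auto
  qed
  have "path J" unfolding J_def using \<psi>(1) by (auto simp: path_def intro!: continuous_intros)
  moreover have "loop_free J" unfolding loop_free_def
  proof (intro ballI impI)
    fix x y :: real assume xy: "x \<in> {0..1}" "y \<in> {0..1}" "J x = J y"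
    consider "x = y" | "x < y" | "y < x" by linarith
    then show "x = y \<or> x = 0 \<and> y = 1 \<or> x = 1 \<and> y = 0"
      using key[of x y] key[of y x] xy by cases auto
  qed
  ultimately have "simple_path J" by (simp add: simple_path_def)
  moreover have "pathfinish J = pathstart J" using \<psi> s by (simp add: pathfinish_def pathstart_def J_def)
  moreover have "path_image J \<subseteq> (\<lambda>w. z + exp w) ` path_image q"
    using \<psi>(4) by (auto simp: path_image_def J_def)
  moreover have "winding_number J z \<noteq> 0"
    unfolding J_def by (rule winding_number_exp_nonzero[OF \<psi>(1)]) (use \<psi> s in simp)
  ultimately show ?thesis using that by blast
qed

text \<open>The exponential maps the strip to an annulus around \<open>z\<close>; paths found in a
  small disc of the annulus are lifted by the branch \<open>L\<close> of the logarithm that takes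
  the value \<open>w\<close> at the centre.\<close>

lemma log_strip_locally_finitely_joined:
  fixes X :: "complex set"
  assumes X: "closed X" "locally connected X" and r: "0 < r1"
    and noB: "\<And>U. U \<in> components (- X) \<Longrightarrow> \<not> U \<subseteq> ball z r2"
    and w: "w \<in> {w. ln r1 < Re w \<and> Re w < ln r2}" and "0 < r2"
  obtains T where "open T" "w \<in> T"
    "\<And>x. x \<in> T \<Longrightarrow> finitely_joined ((\<lambda>w. z + exp w) -` frontier X) {w. ln r1 < Re w \<and> Re w < ln r2} w x"
proof -
  let ?S = "{w. ln r1 < Re w \<and> Re w < ln r2}" and ?h = "\<lambda>w. z + exp w" and ?A = "ball z r2 - cball z r1"
  have hA: "?h x \<in> ?A \<longleftrightarrow> x \<in> ?S" for x
  proof -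
    have "dist z (?h x) = exp (Re x)" by (simp add: dist_norm norm_exp_eq_Re)
    moreover have "ln r1 < Re x \<longleftrightarrow> exp (ln r1) < exp (Re x)" "Re x < ln r2 \<longleftrightarrow> exp (Re x) < exp (ln r2)"
      by (simp_all only: exp_less_cancel_iff)
    ultimately show ?thesis using r \<open>0 < r2\<close> by auto
  qed
  define c where "c = ?h w"
  have "open ?A" by (intro open_Diff) auto
  moreover have "c \<in> ?A" unfolding c_def hA by (rule w)
  ultimately obtain e0 where e0: "e0 > 0" "ball c e0 \<subseteq> ?A" using openE by blast
  \<comment> \<open>\<open>norm (exp w)\<close> is the distance from \<open>c\<close> to
    \<open>z\<close>; staying below it keeps \<open>(x - z) / exp w\<close> in the right half-plane,
    where \<open>Ln\<close> is continuous.\<close>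
  define e where "e = min e0 (norm (exp w))"
  have e: "e > 0" "ball c e \<subseteq> ?A" using e0 by (auto simp: e_def)
  define L where "L x = w + Ln ((x - z) / exp w)" for x
  have Re: "Re ((x - z) / exp w) > 0" if "x \<in> ball c e" for x
  proof -
    have "(x - z) / exp w - 1 = (x - c) / exp w" by (simp add: c_def divide_simps)
    then have "norm ((x - z) / exp w - 1) = norm (x - c) / norm (exp w)" by (simp only: norm_divide)
    also have "\<dots> < 1" using that by (simp add: e_def dist_norm norm_minus_commute)
    finally have "norm ((x - z) / exp w - 1) < 1" .
    then show ?thesis using abs_Re_le_cmod[of "(x - z) / exp w - 1"] by auto
  qed
  have hL: "?h (L x) = x" if "x \<in> ball c e" for x
  proof -
    have "(x - z) / exp w \<noteq> 0" using Re[OF that] by auto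
    then show ?thesis by (simp add: L_def exp_add exp_Ln)
  qed
  have cL: "continuous_on (ball c e) L" unfolding L_def
  proof (intro continuous_intros)
    show "(x - z) / exp w \<notin> \<real>\<^sub>\<le>\<^sub>0" if "x \<in> ball c e" for x
      using Re[OF that] by (metis complex_nonpos_Reals_iff not_le)
  qed auto
  \<comment> \<open>The unit disc keeps \<open>Im (x - w)\<close> between \<open>-pi\<close> and
    \<open>pi\<close>, so that \<open>L\<close> sends \<open>?h x\<close> back to \<open>x\<close>
    and not to another logarithm.\<close>
  define T where "T = ball w 1 \<inter> ?h -` ball c (e/2)"
  have "open T" unfolding T_def by (intro open_Int open_vimage continuous_intros) auto
  moreover have "w \<in> T" using e by (simp add: T_def c_def)
  moreover have "finitely_joined (?h -` frontier X) ?S w x" if x: "x \<in> T" for x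
  proof -
    have "ball c e \<subseteq> ball z r2" using e by auto
    then have "finitely_joined (frontier X) (ball c e) c (?h x)"
      using x noB by (intro finitely_joined_in_ball[OF X]) (auto simp: T_def)
    then obtain g where g: "path g" "path_image g \<subseteq> ball c e" "pathstart g = c" "pathfinish g = ?h x"
        "finite (path_image g \<inter> frontier X)"
      unfolding finitely_joined_def by blast
    have im: "path_image (L \<circ> g) = L ` path_image g" by (simp add: path_image_compose)
    have "path (L \<circ> g)" using g cL by (intro path_continuous_image) (auto intro: continuous_on_subset)
    moreover have "path_image (L \<circ> g) \<subseteq> ?S"
    proof -
      have "L y \<in> ?S" if "y \<in> path_image g" for y
      proof -
        have "y \<in> ball c e" using that g(2) by blast
        then show ?thesis unfolding hA[symmetric] using hL[of y] e(2) by (simp only: subset_iff)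
      qed
      then show ?thesis unfolding im by blast
    qed
    moreover have "pathstart (L \<circ> g) = w" using g by (simp add: pathstart_compose L_def c_def)
    moreover have "pathfinish (L \<circ> g) = x"
    proof -
      have "norm (x - w) < 1" using x by (simp add: T_def dist_norm norm_minus_commute)
      then have "\<bar>Im (x - w)\<bar> < 1" using abs_Im_le_cmod[of "x - w"] by linarith
      then have "Ln (exp (x - w)) = x - w" using pi_gt3 by (intro Ln_exp) linarith+
      then show ?thesis using g by (simp add: pathfinish_compose L_def exp_diff)
    qed
    moreover have "finite (path_image (L \<circ> g) \<inter> ?h -` frontier X)"
    proof (rule finite_subset)
      show "path_image (L \<circ> g) \<inter> ?h -` frontier X \<subseteq> L ` (path_image g \<inter> frontier X)"
      proof
        fix v assume "v \<in> path_image (L \<circ> g) \<inter> ?h -` frontier X"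
        then obtain y where "y \<in> path_image g" "v = L y" "?h v \<in> frontier X" unfolding im by blast
        then show "v \<in> L ` (path_image g \<inter> frontier X)" using hL[of y] g(2) by auto
      qed
    qed (use g in simp)
    ultimately show ?thesis unfolding finitely_joined_def by blast
  qed
  ultimately show ?thesis using that by blast
qed

text \<open>No circle has to be subdivided: each point of the strip is joined to all points near it,
  and an equivalence relation with this property on a connected set relates any two points.\<close>

lemma simple_loop_with_finite_frontier_crossing:
  fixes X :: "complex set"
  assumes X: "closed X" "locally connected X" and r: "0 < r"
    and noB: "\<And>U. U \<in> components (- X) \<Longrightarrow> \<not> U \<subseteq> ball z r"
  obtains J where "simple_path J" "pathfinish J = pathstart J" "path_image J \<subseteq> ball z r"
    "finite (path_image J \<inter> frontier X)" "winding_number J z \<noteq> 0" "z \<notin> path_image J"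
proof -
  let ?S = "{w. ln (r/3) < Re w \<and> Re w < ln r}" and ?h = "\<lambda>w. z + exp w"
  let ?R = "finitely_joined (?h -` frontier X) ?S"
  \<comment> \<open>\<open>a\<close> is a logarithm of \<open>r/2\<close>, which lies between
    \<open>r/3\<close> and \<open>r\<close>, and \<open>b\<close> is the next one. A path from
    \<open>a\<close> to \<open>b\<close> in the strip covers a loop around \<open>z\<close>.\<close>
  define a where "a = complex_of_real (ln (r/2))"
  define b where "b = a + 2 * of_real pi * \<i>"
  have ab: "a \<in> ?S" "b \<in> ?S" using r by (auto simp: a_def b_def)
  have "convex ({w. ln (r/3) < Re w} \<inter> {w. Re w < ln r})"
    by (intro convex_Int convex_halfspace_Re_gt convex_halfspace_Re_lt)
  then have "connected ?S" by (simp add: convex_connected Int_def)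
  then have "?R a b"
  proof (rule connected_equivalence_relation[OF _ ab])
    show "?R y x" if "?R x y" for x y using that by (rule finitely_joined_sym)
    show "?R x w" if "?R x y" "?R y w" for x y w using that by (rule finitely_joined_trans)
    show "\<exists>T. openin (top_of_set ?S) T \<and> w \<in> T \<and> (\<forall>x\<in>T. ?R w x)" if w: "w \<in> ?S" for w
    proof -
      obtain T where "open T" "w \<in> T" "\<And>x. x \<in> T \<Longrightarrow> ?R w x"
        using log_strip_locally_finitely_joined[OF X _ noB w] r by auto
      then show ?thesis using w by (intro exI[of _ "?S \<inter> T"]) (auto simp: openin_open_Int)
    qed
  qed
  then obtain p where p: "path p" "path_image p \<subseteq> ?S" "pathstart p = a" "pathfinish p = b"
      "finite (path_image p \<inter> ?h -` frontier X)"
    unfolding finitely_joined_def by blast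
  have "a \<noteq> b" by (simp add: b_def)
  then obtain q where q: "arc q" "path_image q \<subseteq> path_image p" "pathstart q = a" "pathfinish q = b"
    using path_contains_arc p by metis
  have "exp (q 0) = exp (q 1)"
    using q(3,4) by (simp add: pathstart_def pathfinish_def b_def exp_add)
  then obtain J where J: "simple_path J" "pathfinish J = pathstart J"
    "path_image J \<subseteq> ?h ` path_image q" "winding_number J z \<noteq> 0"
    using simple_loop_from_logarithmic_arc[OF q(1)] by blast
  have "path_image J \<subseteq> ball z r"
  proof -
    have "?h w \<in> ball z r" if "w \<in> ?S" for w
    proof -
      have "exp (Re w) < exp (ln r)" using that by simp
      then show ?thesis using r by (simp add: dist_norm norm_exp_eq_Re)
    qed
    then show ?thesis using J(3) q(2) p(2) by blast
  qed
  moreover have "finite (path_image J \<inter> frontier X)"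
  proof (rule finite_subset)
    show "path_image J \<inter> frontier X \<subseteq> ?h ` (path_image p \<inter> ?h -` frontier X)"
      using J(3) q(2) by blast
  qed (use p in simp)
  moreover have "z \<notin> path_image J" using J(3) by auto
  ultimately show ?thesis using that J by blast
qed

subsection \<open>Good cuts of a locally connected continuum\<close>

lemma pathin_Some: "path J \<Longrightarrow> pathin extended_plane (Some \<circ> J)"
  using pathin_canon_iff[of UNIV J] by (intro pathin_compose[OF _ continuous_map_Some]) simp

text \<open>
  Good cuts in the finite plane suffice.
\<close>

definition separating_loop :: "complex set \<Rightarrow> complex \<Rightarrow> complex \<Rightarrow> (real \<Rightarrow> complex) \<Rightarrow> bool" where
  "separating_loop X x y J \<longleftrightarrow>
     simple_path J \<and> pathfinish J = pathstart J \<and>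
     finite (path_image J \<inter> frontier X) \<and> path_image J \<inter> frontier X \<noteq> {} \<and> path_image J - X \<noteq> {} \<and>
     x \<notin> path_image J \<and> y \<notin> path_image J \<and> \<not> connected_component (- path_image J) x y"

lemma good_cut_separating_loop:
  assumes "separating_loop X x y J"
  shows "good_cut X (Some \<circ> J)" "separated_by (Some \<circ> J) x y"
proof -
  note J = assms[unfolded separating_loop_def]
  have im: "(Some \<circ> J) ` {0..1} = Some ` path_image J" by (simp add: path_image_def image_comp)
  have "Some ` path_image J \<inter> Some ` frontier X = Some ` (path_image J \<inter> frontier X)"
       "Some ` path_image J - Some ` X = Some ` (path_image J - X)" by auto
  moreover have "simple_closed_curve_in extended_plane (Some \<circ> J)"
    using J pathin_Some simple_path_imp_path[of J]
    by (auto simp: simple_closed_curve_in_def simple_path_def loop_free_def pathstart_def pathfinish_def)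
  ultimately show "good_cut X (Some \<circ> J)" unfolding good_cut_def im using J by simp
  have S: "{z. Some z \<notin> (Some \<circ> J) ` {0..1}} = - path_image J" unfolding im by auto
  show "separated_by (Some \<circ> J) x y"
    unfolding separated_by_def S
  proof (intro bexI conjI)
    show "connected_component_set (- path_image J) x \<noteq> connected_component_set (- path_image J) y"
      using J by (metis Compl_iff connected_component_refl_eq mem_Collect_eq)
    show "connected_component_set (- path_image J) y \<in> components (- path_image J)"
         "connected_component_set (- path_image J) x \<in> components (- path_image J)"
      using J by (auto simp: components_def)
  qed (use J in auto)
qed

lemma separating_loop_around_frontier_point:
  fixes X :: "complex set"
  assumes X: "compact X" "connected X" "locally connected X" "finite (components (- X))"
    and z: "z \<in> frontier X" and y: "y \<in> X" "y \<noteq> z"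
  obtains J where "separating_loop X z y J" "z \<in> inside (path_image J)"
proof -
  have clX: "closed X" using X by (simp add: compact_imp_closed)
  have zX: "z \<in> X" using z clX frontier_subset_closed by blast
  have "\<exists>p. p \<in> U" if "U \<in> components (- X)" for U using in_components_nonempty[OF that] by blast
  then obtain p where p: "\<And>U. U \<in> components (- X) \<Longrightarrow> p U \<in> U" by metis
  \<comment> \<open>The disc of radius \<open>d\<close> excludes \<open>y\<close> and one chosen
    point of each component of the complement. These are finitely many, so \<open>d\<close> is
    positive.\<close>
  define d where "d = Min (insert (dist z y) ((\<lambda>U. dist z (p U)) ` components (- X)))"
  have pX: "p U \<notin> X" if "U \<in> components (- X)" for U
    using p[OF that] in_components_subset[OF that] by blast
  then have "p U \<noteq> z" if "U \<in> components (- X)" for U using zX that by blast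
  then have "d > 0" unfolding d_def using X(4) y by (subst Min_gr_iff) fastforce+
  have d: "d \<le> dist z y" "\<And>U. U \<in> components (- X) \<Longrightarrow> d \<le> dist z (p U)"
    unfolding d_def using X(4) by (auto intro!: Min_le)
  have noB: "\<not> U \<subseteq> ball z d" if "U \<in> components (- X)" for U
    using d(2)[OF that] p[OF that] by force
  obtain J where J: "simple_path J" "pathfinish J = pathstart J" "path_image J \<subseteq> ball z d"
    "finite (path_image J \<inter> frontier X)" "winding_number J z \<noteq> 0" "z \<notin> path_image J"
    using simple_loop_with_finite_frontier_crossing[OF clX X(3) \<open>d > 0\<close> noB] by blast
  let ?I = "inside (path_image J)" and ?O = "outside (path_image J)"
  have JIO: "open ?I" "open ?O" "?I \<inter> ?O = {}" "?I \<union> ?O = - path_image J"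
    using Jordan_inside_outside[OF J(1,2)] by blast+
  have "z \<notin> ?O" using winding_number_zero_in_outside[OF simple_path_imp_path[OF J(1)] J(2)] J(5) by blast
  then have zI: "z \<in> ?I" using J(6) JIO(4) by blast
  have out: "- ball z d \<subseteq> ?O" by (rule outside_subset_convex[OF convex_ball J(3)])
  have yO: "y \<in> ?O" using out d(1) by auto
  have sep: "T \<inter> path_image J \<noteq> {}" if "connected T" "T \<inter> ?I \<noteq> {}" "T \<inter> ?O \<noteq> {}" for T
  proof
    assume "T \<inter> path_image J = {}"
    then have "T \<subseteq> ?I \<union> ?O" using JIO(4) by blast
    then have "T \<subseteq> ?I" using connected_subset_open_part[OF that(1) _ JIO(1,2,3) that(2)] by blast
    then show False using that(3) JIO(3) by blast
  qed
  have "\<not> connected_component (- path_image J) z y"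
  proof
    assume "connected_component (- path_image J) z y"
    then obtain T where "connected T" "T \<subseteq> - path_image J" "z \<in> T" "y \<in> T"
      unfolding connected_component_def by blast
    then show False using sep[of T] zI yO by blast
  qed
  \<comment> \<open>Near \<open>z\<close> some component of the complement enters the inside of
    \<open>J\<close>; its chosen point is outside, so it crosses \<open>J\<close>.\<close>
  moreover have JX: "path_image J - X \<noteq> {}"
  proof -
    have "z \<in> closure (- X)" using z by (simp add: frontier_closures)
    then obtain q where q: "q \<in> ?I" "q \<notin> X"
      using zI JIO(1) open_Int_closure_eq_empty[of ?I "- X"] by blast
    then obtain U where U: "U \<in> components (- X)" "q \<in> U" by (metis Compl_iff UnionE Union_components)
    have "p U \<in> ?O" using out d(2)[OF U(1)] by auto
    then have "U \<inter> path_image J \<noteq> {}"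
      using sep[of U] U q p[OF U(1)] in_components_connected by blast
    then show ?thesis using in_components_subset[OF U(1)] by blast
  qed
  \<comment> \<open>\<open>X\<close> joins \<open>z\<close> inside to \<open>y\<close> outside and
    so meets \<open>J\<close>; as \<open>J\<close> is connected and also leaves \<open>X\<close>, it
    meets the frontier.\<close>
  moreover have "path_image J \<inter> frontier X \<noteq> {}"
  proof (rule connected_Int_frontier)
    show "connected (path_image J)" using J(1) connected_simple_path_image by blast
    show "path_image J \<inter> X \<noteq> {}" using sep[OF X(2)] zX y(1) zI yO by blast
  qed (rule JX)
  moreover have "y \<notin> path_image J" using yO JIO(4) by blast
  ultimately have "separating_loop X z y J" using J by (simp add: separating_loop_def)
  then show ?thesis using that zI by blast
qed

text \<open>The punctured plane is connected and not contained in the bounded set \<open>W\<close>,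
  so it contains a frontier point of \<open>W\<close>.\<close>

lemma frontier_avoiding_point:
  fixes W :: "complex set"
  assumes "bounded W" "x \<in> W" "x \<noteq> y"
  obtains z where "z \<in> frontier W" "z \<noteq> y"
proof -
  have "\<not> bounded (- {y})" using cobounded_imp_unbounded[of "- {y}"] by simp
  then have "\<not> - {y} \<subseteq> W" using assms(1) bounded_subset by blast
  moreover have "connected (- {y})" by (rule connected_punctured_universe) simp
  ultimately have "- {y} \<inter> frontier W \<noteq> {}"
    using assms by (intro connected_Int_frontier) auto
  then show ?thesis using that by blast
qed

lemma frontier_component_interior:
  fixes X :: "'a::real_normed_vector set"
  assumes W: "W \<in> components (interior X)" and "closed X"
  shows "frontier W \<subseteq> frontier X"
proof
  fix z assume z: "z \<in> frontier W"
  have oW: "open W" using W open_components open_interior by blast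
  have "W \<subseteq> interior X" using in_components_subset[OF W] .
  then have zX: "z \<in> X" "z \<in> closure W"
    using z interior_subset[of X] closure_minimal[OF _ \<open>closed X\<close>, of W] by (auto simp: frontier_def)
  have "z \<notin> interior X"
  proof
    assume "z \<in> interior X"
    then have "insert z W \<subseteq> W"
      using in_components_connected[OF W] in_components_nonempty[OF W] in_components_subset[OF W] zX
      by (intro components_maximal[OF W] in_closure_imp_connected_insert) auto
    then show False using z oW by (simp add: frontier_def interior_open)
  qed
  then show "z \<in> frontier X" using zX(1) closure_subset by (auto simp: frontier_def)
qed

text \<open>
  An interior point \<open>x\<close> is moved, by a homeomorphism supported in its component of the
  interior, to the inside of a separating loop around a frontier point.
\<close>

lemma ex_separating_loop:
  fixes X :: "complex set"
  assumes X: "compact X" "connected X" "locally connected X" "finite (components (- X))"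
    and x: "x \<in> X" and y: "y \<in> X" "y \<noteq> x"
  shows "\<exists>J. separating_loop X x y J"
proof (cases "x \<in> frontier X")
  case True
  then show ?thesis using separating_loop_around_frontier_point[OF X True y] by metis
next
  case False
  have clX: "closed X" using X by (simp add: compact_imp_closed)
  have "x \<in> interior X" using False x clX by (simp add: frontier_def)
  then obtain W where W: "W \<in> components (interior X)" "x \<in> W" by (metis UnionE Union_components)
  have oW: "open W" and cW: "connected W" and sW: "W \<subseteq> interior X"
    using W(1) open_components open_interior in_components_connected in_components_subset by blast+
  have "bounded W" using sW interior_subset[of X] bounded_subset[OF compact_imp_bounded[OF X(1)]] by blast
  then obtain z where z: "z \<in> frontier W" "z \<noteq> y" using frontier_avoiding_point[OF _ W(2)] y(2) by metis
  have zX: "z \<in> frontier X" using z(1) frontier_component_interior[OF W(1) clX] by blast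
  obtain J where J: "separating_loop X z y J" "z \<in> inside (path_image J)"
    using separating_loop_around_frontier_point[OF X zX y(1)] z(2) by metis
  note Jd = J(1)[unfolded separating_loop_def]
  have oI: "open (inside (path_image J))" "connected (inside (path_image J))"
    using Jordan_inside_outside Jd by blast+
  have "z \<in> closure W" using z(1) by (simp add: frontier_def)
  then obtain x' where x': "x' \<in> W" "x' \<in> inside (path_image J)"
    using J(2) oI(1) open_Int_closure_eq_empty[of "inside (path_image J)" W] by blast
  have IJ: "inside (path_image J) \<inter> path_image J = {}" by (rule inside_no_overlap)
  have cIz: "connected_component (- path_image J) z x'"
    unfolding connected_component_def using oI(2) J(2) x'(2) IJ by blast
  then have sep: "\<not> connected_component (- path_image J) x' y"
    using Jd connected_component_trans by blast
  moreover have "x' \<in> - path_image J" using x'(2) IJ by blast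
  ultimately have "x' \<noteq> y" using connected_component_refl by blast
  \<comment> \<open>With \<open>y\<close> taken out of the support, the homeomorphism fixes
    \<open>y\<close>; a plane domain stays connected when a point is deleted.\<close>
  have op: "open (W - {y})" using oW by (simp add: open_Diff)
  have ne: "x \<in> W - {y}" "x' \<in> W - {y}" using W(2) y(2) x'(1) \<open>x' \<noteq> y\<close> by auto
  have con: "connected (W - {y})" using connected_open_delete[OF oW cW] by simp
  have aff: "affine hull (W - {y}) = UNIV" using affine_hull_open[OF op] ne by blast
  obtain f g where fg: "homeomorphism UNIV UNIV f g" "f x = x'" "{v. \<not> (f v = v \<and> g v = v)} \<subseteq> W - {y}"
    by (rule homeomorphism_moving_point[of "W - {y}" UNIV x x']) (use aff op con ne in auto)
  have gfix: "f v = v" "g v = v" if "v \<notin> W - {y}" for v using fg(3) that by blast+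
  have gf: "g (f v) = v" "f (g v) = v" for v using fg(1) by (auto simp: homeomorphism_def)
  have cont: "continuous_on A f" "continuous_on A g" for A
    using fg(1) continuous_on_subset by (auto simp: homeomorphism_def)
  have "inj g" using gf by (metis injI)
  have fr: "frontier X \<inter> W = {}" using sW by (auto simp: frontier_def)
  let ?J = "g \<circ> J"
  have im: "path_image ?J = g ` path_image J" by (rule path_image_compose)
  \<comment> \<open>The support lies in the interior of \<open>X\<close>, so frontier points stay
    fixed and no other point is moved onto one.\<close>
  have eq: "g ` path_image J \<inter> frontier X = path_image J \<inter> frontier X"
  proof -
    have "g v = v" if "g v \<in> frontier X" for v
    proof -
      have "f (g v) = g v" using that fr by (intro gfix(1)) blast
      then show ?thesis using gf by simp
    qed
    moreover have "g v = v" if "v \<in> frontier X" for v using that fr by (intro gfix(2)) blast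
    ultimately show ?thesis by (auto simp: image_iff) metis+
  qed
  have "separating_loop X x y ?J"
    unfolding separating_loop_def im eq
  proof (intro conjI)
    show "simple_path ?J"
      using Jd cont(2) \<open>inj g\<close> by (intro simple_path_continuous_image) (auto intro: inj_on_subset)
    show "pathfinish ?J = pathstart ?J" using Jd by (simp add: pathfinish_compose pathstart_compose)
    obtain v where v: "v \<in> path_image J" "v \<notin> X" using Jd by blast
    then have "g v = v" using sW interior_subset[of X] by (intro gfix) blast
    then show "g ` path_image J - X \<noteq> {}" using v by force
    show "x \<notin> g ` path_image J" using gf fg(2) x'(2) IJ by (metis disjoint_iff imageE)
    have "f y = y" by (intro gfix) simp
    then show "y \<notin> g ` path_image J" using gf Jd by (metis imageE)
    show "\<not> connected_component (- g ` path_image J) x y"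
    proof
      assume "connected_component (- g ` path_image J) x y"
      then obtain T where T: "connected T" "T \<subseteq> - g ` path_image J" "x \<in> T" "y \<in> T"
        unfolding connected_component_def by blast
      have "connected (f ` T)" using T(1) cont(1) connected_continuous_image by blast
      moreover have "f ` T \<subseteq> - path_image J" using T(2) gf by (auto simp: image_iff) (metis ComplD image_eqI subsetD)
      moreover have "x' \<in> f ` T" "y \<in> f ` T" using T(3,4) fg(2) \<open>f y = y\<close> by (metis imageI)+
      ultimately show False using sep unfolding connected_component_def by blast
    qed
  qed (use Jd in auto)
  then show ?thesis by blast
qed

lemma pseudo_fiber_trivial_if_locally_connected:
  fixes X :: "complex set"
  assumes X: "compact X" "connected X" "locally connected X" "finite (components (- X))" and x: "x \<in> X"
  shows "pseudo_fiber X x = {x}"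
proof -
  have "\<not> separated_by \<gamma> x x" for \<gamma>
    unfolding separated_by_def by (metis IntI components_nonoverlap empty_iff)
  moreover have "\<exists>\<gamma>. good_cut X \<gamma> \<and> separated_by \<gamma> x y" if "y \<in> X" "y \<noteq> x" for y
    using ex_separating_loop[OF X x that] good_cut_separating_loop by blast
  ultimately show ?thesis using x by (auto simp: pseudo_fiber_def)
qed

subsection \<open>Fibers of a continuum that is not locally connected\<close>

text \<open>Boundary bumping: a component of a proper closed part of a continuum meets the relative
  frontier of that part, and the frontier of \<open>X \<inter> cball x r\<close> in \<open>X\<close>
  contains no point of the open disc.\<close>

lemma component_reaches_sphere:
  fixes X :: "'a::euclidean_space set"
  assumes X: "compact X" "connected X" and y: "y \<in> X" "dist x y \<le> r" and n: "\<not> X \<subseteq> cball x r"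
  obtains q where "connected_component (X \<inter> cball x r) y q" "r \<le> dist x q"
proof -
  let ?T = "top_of_set X" and ?S = "X \<inter> cball x r"
  let ?C = "connected_component_of_set (subtopology ?T ?S) y"
  have "?C \<in> connected_components_of (subtopology ?T ?S)"
    using y by (auto simp: connected_components_of_def)
  moreover have "connected_space ?T" "compact_space ?T" "Hausdorff_space ?T"
  proof -
    have "connectedin euclidean X" "compactin euclidean X" using X by simp_all
    then show "connected_space ?T" "compact_space ?T"
      by (simp_all add: connectedin_def compact_space_subtopology)
    show "Hausdorff_space ?T" by (simp add: Hausdorff_space_subtopology)
  qed
  moreover have "closedin ?T ?S" by (simp add: closedin_closed_Int)
  moreover have "?S \<noteq> topspace ?T" using n by auto
  ultimately have "?C \<inter> ?T frontier_of ?S \<noteq> {}" by (intro boundary_bumping_theorem_closed) auto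
  then obtain q where q: "connected_component_of (subtopology ?T ?S) y q" "q \<in> ?T frontier_of ?S" by auto
  have "connected_component ?S y q"
  proof -
    obtain A where "connectedin (subtopology ?T ?S) A" "y \<in> A" "q \<in> A"
      using q(1) unfolding connected_component_of_def by blast
    then show ?thesis unfolding connected_component_def connectedin_subtopology connectedin_iff_connected by blast
  qed
  moreover have "r \<le> dist x q"
  proof (rule ccontr)
    assume "\<not> r \<le> dist x q"
    have "X \<inter> ball x r \<subseteq> ?T interior_of ?S"
      by (rule interior_of_maximal) (auto simp: openin_open_Int)
    moreover have "q \<in> X \<inter> ball x r"
      using calculation \<open>\<not> r \<le> dist x q\<close> connected_component_in[OF \<open>connected_component ?S y q\<close>] by auto
    ultimately show False using q(2) by (auto simp: frontier_of_def)
  qed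
  ultimately show ?thesis using that by blast
qed

section \<open>Good cuts in the one-point compactification\<close>

text \<open>\<open>Some\<close> embeds the plane in its compactification, so pieces of a cut that
  avoid infinity can be treated as connected sets in the plane.\<close>

lemma connected_vimage_Some:
  assumes "pathin extended_plane \<gamma>" "connected P" "P \<subseteq> {0..1}" "\<gamma> ` P \<subseteq> range Some"
  shows "connected {z. Some z \<in> \<gamma> ` P}"
proof -
  have "connectedin (top_of_set {0..1}) P" using assms by (simp add: connectedin_subtopology)
  then have "connectedin extended_plane (\<gamma> ` P)"
    using assms(1) connectedin_continuous_map_image unfolding pathin_def by blast
  moreover have eq: "Some ` {z. Some z \<in> A} = A" if "A \<subseteq> range Some" for A :: "complex option set"
    using that by auto
  ultimately have 1: "connectedin (subtopology extended_plane (range Some)) (Some ` {z. Some z \<in> \<gamma> ` P})"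
    unfolding connectedin_subtopology using assms(4) by simp
  have "homeomorphic_map euclidean (subtopology extended_plane (Some ` topspace euclidean)) Some"
    using embedding_map_Some[of "euclidean :: complex topology"] unfolding embedding_map_def .
  from homeomorphic_map_connectedness[OF this, of "{z. Some z \<in> \<gamma> ` P}"] 1
  show ?thesis by simp
qed

lemma finite_good_cut_times:
  assumes "good_cut X \<gamma>"
  shows "finite {t \<in> {0..1}. \<gamma> t \<in> Some ` frontier X}"
proof -
  let ?F = "{t \<in> {0..1}. \<gamma> t \<in> Some ` frontier X}"
  \<comment> \<open>Only the times 0 and 1 share a value, so leaving out 1 makes the cut
    injective.\<close>
  have "inj_on \<gamma> (?F - {1})"
  proof (rule inj_onI)
    fix s t assume "s \<in> ?F - {1}" "t \<in> ?F - {1}" "\<gamma> s = \<gamma> t"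
    then show "s = t" using assms by (auto simp only: good_cut_def simple_closed_curve_in_def)
  qed
  moreover have "finite (\<gamma> ` (?F - {1}))"
    by (rule finite_subset[of _ "\<gamma> ` {0..1} \<inter> Some ` frontier X"]) (use assms in \<open>auto simp: good_cut_def\<close>)
  ultimately have "finite (?F - {1})" by (rule finite_imageD[rotated])
  then show ?thesis by simp
qed

lemma open_good_cut_complement:
  assumes "good_cut X \<gamma>"
  shows "open {z. Some z \<notin> \<gamma> ` {0..1}}"
proof -
  have "compactin (top_of_set {0..1}) {0..1::real}" by (simp add: compactin_subtopology)
  moreover have "continuous_map (top_of_set {0..1}) extended_plane \<gamma>"
    using assms by (simp add: good_cut_def simple_closed_curve_in_def pathin_def)
  ultimately have "compactin extended_plane (\<gamma> ` {0..1})" by (rule image_compactin)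
  moreover have "Hausdorff_space extended_plane"
    by (simp add: Hausdorff_space_Alexandroff_compactification locally_compact_space_euclidean)
  ultimately have "closedin extended_plane (\<gamma> ` {0..1})" by (intro compactin_imp_closedin)
  then have "closedin euclidean {z \<in> topspace euclidean. Some z \<in> \<gamma> ` {0..1}}"
    by (rule closedin_continuous_map_preimage[OF continuous_map_Some])
  then have "closed {z. Some z \<in> \<gamma> ` {0..1}}" by simp
  then show ?thesis by (simp add: Collect_neg_eq open_Compl)
qed

text \<open>
  A good cut meeting infinitely many of the sets \<open>Q n\<close> meets infinitely many of them in one
  connected piece of \<open>X\<close> close to \<open>x\<close>, since it crosses the boundary of \<open>X\<close> finitely often.
\<close>

lemma good_cut_hits_one_component_frequently:
  fixes X :: "complex set"
  assumes X: "closed X" and \<gamma>: "good_cut X \<gamma>"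
    and hits: "\<And>N. \<exists>n\<ge>N. \<exists>g\<in>X \<inter> cball x s. Some g \<in> \<gamma> ` {0..1} \<and> connected_component (X \<inter> cball x e) (y n) g"
    and se: "s < e"
  obtains p where "\<And>N::nat. \<exists>n\<ge>N. connected_component (X \<inter> cball x e) (y n) p"
proof -
  note result = that
  let ?D = "X \<inter> cball x e"
  have pg: "pathin extended_plane \<gamma>" using \<gamma> by (simp add: good_cut_def simple_closed_curve_in_def)
  have "\<exists>n t g. n \<ge> N \<and> t \<in> {0..1} \<and> g \<in> X \<inter> cball x s \<and> \<gamma> t = Some g \<and> connected_component ?D (y n) g" for N
    using hits[of N] by force
  then obtain n t g where ntg: "\<And>N. n N \<ge> N \<and> t N \<in> {0..1} \<and> g N \<in> X \<inter> cball x s \<and> \<gamma> (t N) = Some (g N) \<and> connected_component ?D (y (n N)) (g N)"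
    by metis
  \<comment> \<open>The hitting times have a limit point \<open>\<tau>\<close>. Closedness puts
    \<open>\<gamma> \<tau>\<close> in the disc of radius \<open>s\<close>, and \<open>s < e\<close>
    leaves room around it.\<close>
  obtain \<tau> \<rho> where \<tau>: "\<tau> \<in> {0..1::real}" "strict_mono (\<rho> :: nat \<Rightarrow> nat)" "(t \<circ> \<rho>) \<longlonglongrightarrow> \<tau>"
    using compact_Icc[of 0 "1::real"] ntg unfolding compact_def by metis
  have cm: "continuous_map (top_of_set {0..1}) extended_plane \<gamma>" using pg by (simp add: pathin_def)
  have "closedin extended_plane (Some ` cball x s)"
    unfolding closedin_Alexandroff_compactification by (intro disjI1 exI[of _ "cball x s"]) auto
  then have "closedin (top_of_set {0..1}) {u \<in> {0..1}. \<gamma> u \<in> Some ` cball x s}"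
    using closedin_continuous_map_preimage[OF cm] by simp
  then have "closed {u \<in> {0..1}. \<gamma> u \<in> Some ` cball x s}" by (rule closedin_closed_trans) simp
  moreover have "(t \<circ> \<rho>) k \<in> {u \<in> {0..1}. \<gamma> u \<in> Some ` cball x s}" for k using ntg[of "\<rho> k"] by auto
  ultimately have "\<tau> \<in> {u \<in> {0..1}. \<gamma> u \<in> Some ` cball x s}" using \<tau>(3) closed_sequentially by blast
  then have \<gamma>\<tau>: "\<gamma> \<tau> \<in> Some ` ball x e" using se by force
  have "openin (top_of_set {0..1}) {u \<in> {0..1}. \<gamma> u \<in> Some ` ball x e}"
    using openin_continuous_map_preimage[OF cm, of "Some ` ball x e"] by simp
  then obtain \<eta>1 where \<eta>1: "\<eta>1 > 0" "ball \<tau> \<eta>1 \<inter> {0..1} \<subseteq> {u \<in> {0..1}. \<gamma> u \<in> Some ` ball x e}"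
    using \<gamma>\<tau> \<tau>(1) unfolding openin_contains_ball by blast
  let ?F = "{u \<in> {0..1}. \<gamma> u \<in> Some ` frontier X}"
  have finF: "finite ?F" using finite_good_cut_times[OF \<gamma>] .
  obtain \<eta>2 where \<eta>2: "\<eta>2 > 0" "\<forall>u\<in>?F. u \<noteq> \<tau> \<longrightarrow> \<eta>2 \<le> dist \<tau> u"
    using finite_set_avoid[OF finF, of \<tau>] by auto
  define \<eta> where "\<eta> = min \<eta>1 \<eta>2"
  have \<eta>: "\<eta> > 0" using \<eta>1 \<eta>2 by (simp add: \<eta>_def)
  \<comment> \<open>Near \<open>\<tau>\<close> the cut stays in the disc of radius \<open>e\<close>
    and, except possibly at \<open>\<tau>\<close>, avoids the frontier. Each one-sided piece is
    connected, hence lies in \<open>X\<close> as soon as it contains a point of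
    \<open>X\<close>.\<close>
  define Pl where "Pl = {0..1} \<inter> {\<tau>-\<eta><..<\<tau>}"
  define Pr where "Pr = {0..1} \<inter> {\<tau><..<\<tau>+\<eta>}"
  have Pb: "\<gamma> ` P \<subseteq> Some ` ball x e" "\<gamma> ` P \<inter> Some ` frontier X = {}" if "P = Pl \<or> P = Pr" for P
  proof -
    have near: "u \<in> {0..1} \<and> dist \<tau> u < \<eta> \<and> u \<noteq> \<tau>" if "u \<in> P" for u
      using that \<open>P = Pl \<or> P = Pr\<close> by (auto simp: Pl_def Pr_def dist_real_def)
    show "\<gamma> ` P \<subseteq> Some ` ball x e"
    proof (rule image_subsetI)
      fix u assume "u \<in> P"
      then have "u \<in> ball \<tau> \<eta>1 \<inter> {0..1}" using near by (auto simp: \<eta>_def)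
      then show "\<gamma> u \<in> Some ` ball x e" using \<eta>1(2) by blast
    qed
    have "u \<notin> ?F" if "u \<in> P" for u using near[OF that] \<eta>2(2) by (auto simp: \<eta>_def)
    then show "\<gamma> ` P \<inter> Some ` frontier X = {}" using near by blast
  qed
  \<comment> \<open>The piece \<open>{\<tau>}\<close> is a case of its own because
    \<open>\<gamma> \<tau>\<close> may lie on the frontier.\<close>
  have fin: ?thesis if P: "P \<subseteq> {0..1}" "connected P" "\<gamma> ` P \<subseteq> Some ` ball x e"
      "\<gamma> ` P \<inter> Some ` frontier X = {} \<or> P = {\<tau>}" and fr: "\<exists>\<^sub>F k in sequentially. (t \<circ> \<rho>) k \<in> P" for P
  proof -
    let ?C = "{z. Some z \<in> \<gamma> ` P}"
    have conC: "connected ?C" using P by (intro connected_vimage_Some[OF pg]) auto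
    obtain k0 where k0: "(t \<circ> \<rho>) k0 \<in> P" using fr frequently_ex by blast
    have gC: "g (\<rho> k) \<in> ?C" if "(t \<circ> \<rho>) k \<in> P" for k
      using ntg[of "\<rho> k"] that by (auto intro!: image_eqI[of _ _ "t (\<rho> k)"])
    have gX: "g N \<in> X" for N using ntg[of N] by simp
    have CX: "?C \<subseteq> X"
    proof (rule disjE[OF P(4)])
      assume *: "\<gamma> ` P \<inter> Some ` frontier X = {}"
      show ?thesis
      proof (rule ccontr)
        assume "\<not> ?C \<subseteq> X"
        then have "?C \<inter> frontier X \<noteq> {}"
          using gC[OF k0] gX[of "\<rho> k0"] by (intro connected_Int_frontier[OF conC]) blast+
        then show False using * by blast
      qed
    next
      assume "P = {\<tau>}"
      then have "\<gamma> \<tau> = Some (g (\<rho> k0))" using gC[OF k0] by auto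
      then have "?C = {g (\<rho> k0)}" using \<open>P = {\<tau>}\<close> by auto
      then show ?thesis using gX by simp
    qed
    moreover have "?C \<subseteq> cball x e" using P(3) by force
    ultimately have CD: "?C \<subseteq> ?D" by blast
    show ?thesis
    proof (rule result[of "g (\<rho> k0)"])
      fix N
      obtain k where k: "k \<ge> N" "(t \<circ> \<rho>) k \<in> P"
        using fr unfolding frequently_sequentially by blast
      have "connected_component ?D (g (\<rho> k)) (g (\<rho> k0))"
        using conC CD gC[OF k0] gC[OF k(2)] unfolding connected_component_def by blast
      moreover have "connected_component ?D (y (n (\<rho> k))) (g (\<rho> k))" using ntg by blast
      ultimately have "connected_component ?D (y (n (\<rho> k))) (g (\<rho> k0))"
        by (rule connected_component_trans[rotated])
      moreover have "N \<le> n (\<rho> k)" using k(1) ntg[of "\<rho> k"] seq_suble[OF \<tau>(2), of k] by linarith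
      ultimately show "\<exists>n\<ge>N. connected_component ?D (y n) (g (\<rho> k0))" by blast
    qed
  qed
  have "\<forall>\<^sub>F k in sequentially. dist ((t \<circ> \<rho>) k) \<tau> < \<eta>" using \<tau>(3) \<eta> by (rule tendstoD)
  then have "\<forall>\<^sub>F k in sequentially. (t \<circ> \<rho>) k \<in> {\<tau>} \<or> (t \<circ> \<rho>) k \<in> Pl \<or> (t \<circ> \<rho>) k \<in> Pr"
    by (rule eventually_mono) (use ntg in \<open>auto simp: Pl_def Pr_def dist_real_def abs_if split: if_splits\<close>)
  then have "\<exists>\<^sub>F k in sequentially. (t \<circ> \<rho>) k \<in> {\<tau>} \<or> (t \<circ> \<rho>) k \<in> Pl \<or> (t \<circ> \<rho>) k \<in> Pr"
    by (rule eventually_frequently[rotated]) simp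
  then consider "\<exists>\<^sub>F k in sequentially. (t \<circ> \<rho>) k \<in> {\<tau>}" | "\<exists>\<^sub>F k in sequentially. (t \<circ> \<rho>) k \<in> Pl"
    | "\<exists>\<^sub>F k in sequentially. (t \<circ> \<rho>) k \<in> Pr"
    unfolding frequently_disj_iff by blast
  then show ?thesis
  proof cases
    case 1
    then show ?thesis by (intro fin[of "{\<tau>}"]) (use \<tau>(1) \<gamma>\<tau> in auto)
  next
    case 2
    have "connected Pl" unfolding Pl_def by (intro convex_connected convex_Int) auto
    then show ?thesis using 2 Pb[of Pl] by (intro fin[of Pl]) (auto simp: Pl_def)
  next
    case 3
    have "connected Pr" unfolding Pr_def by (intro convex_connected convex_Int) auto
    then show ?thesis using 3 Pb[of Pr] by (intro fin[of Pr]) (auto simp: Pr_def)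
  qed
qed

lemma fiber_nontrivial_if_not_locally_connected:
  fixes X :: "complex set"
  assumes X: "compact X" "connected X" and nlc: "\<not> locally connected X"
  obtains x where "x \<in> X" "fiber X x \<noteq> {x}"
proof -
  have clX: "closed X" using X by (simp add: compact_imp_closed)
  \<comment> \<open>Connectedness im kleinen at every point is equivalent to local connectedness, so
    it fails at some \<open>x\<close>: points arbitrarily near \<open>x\<close> are not joined to it
    within \<open>v\<close>.\<close>
  obtain v x where v: "openin (top_of_set X) v" "x \<in> v"
    and nb: "\<not> (\<exists>u. openin (top_of_set X) u \<and> x \<in> u \<and> u \<subseteq> v \<and>
      (\<forall>y. y \<in> u \<longrightarrow> (\<exists>c. connected c \<and> c \<subseteq> v \<and> x \<in> c \<and> y \<in> c)))"
    using nlc unfolding locally_connected_im_kleinen by metis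
  have bad: "\<exists>y\<in>u. \<not> (\<exists>c. connected c \<and> c \<subseteq> v \<and> x \<in> c \<and> y \<in> c)"
    if "openin (top_of_set X) u" "x \<in> u" "u \<subseteq> v" for u
    using nb that by blast
  have xX: "x \<in> X" using v openin_imp_subset by blast
  obtain e where e: "e > 0" "cball x e \<inter> X \<subseteq> v"
    using v unfolding openin_contains_cball by blast
  let ?D = "X \<inter> cball x e" and ?D' = "X \<inter> cball x (e/2)"
  define r where "r n = e / 2 / real (Suc n)" for n
  have r: "r n > 0" "r n \<le> e/2" for n using e(1) by (auto simp: r_def field_simps)
  have rmono: "r m \<le> r n" if "n \<le> m" for m n
    unfolding r_def using e(1) that by (intro divide_left_mono) auto
  have rlim: "r \<longlonglongrightarrow> 0" unfolding r_def by (rule LIMSEQ_Suc) (rule lim_const_over_n)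
  have "\<exists>y\<in>X. dist x y < r n \<and> \<not> connected_component ?D x y" for n
  proof -
    have "X \<inter> ball x (r n) \<subseteq> v" using e r(2)[of n] by force
    then obtain y where y: "y \<in> X \<inter> ball x (r n)" "\<not> (\<exists>c. connected c \<and> c \<subseteq> v \<and> x \<in> c \<and> y \<in> c)"
      using bad[of "X \<inter> ball x (r n)"] xX r(1)[of n] by (auto simp: openin_open_Int)
    moreover have "?D \<subseteq> v" using e(2) by blast
    ultimately show ?thesis unfolding connected_component_def by (intro bexI[of _ y]) auto
  qed
  then obtain y where y: "\<And>n. y n \<in> X" "\<And>n. dist x (y n) < r n" "\<And>n. \<not> connected_component ?D x (y n)"
    by metis
  have ylim: "y \<longlonglongrightarrow> x"
  proof (rule metric_tendsto_imp_tendsto[OF rlim])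
    show "\<forall>\<^sub>F n in sequentially. dist (y n) x \<le> dist (r n) 0"
      using y(2) r(1) by (intro always_eventually allI) (simp add: dist_commute less_imp_le)
  qed
  have yD': "y n \<in> ?D'" for n using y(1,2)[of n] r(2)[of n] by auto
  have xD: "x \<in> ?D" using xX e(1) by simp
  have "\<not> X \<subseteq> cball x (e/2)"
  proof
    assume "X \<subseteq> cball x (e/2)"
    then have "X \<subseteq> ?D" using e(1) by force
    then show False using y(1,3)[of 0] X(2) xX unfolding connected_component_def by blast
  qed
  then have "\<exists>q. connected_component ?D' (y n) q \<and> e/2 \<le> dist x q" for n
    using component_reaches_sphere[OF X y(1)] yD'[of n] by (metis IntD2 mem_cball)
  then obtain q where q: "\<And>n. connected_component ?D' (y n) (q n)" "\<And>n. e/2 \<le> dist x (q n)" by metis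
  define Q where "Q n = connected_component_set ?D' (y n)" for n
  have Q: "connected (Q n)" "y n \<in> Q n" "q n \<in> Q n" "Q n \<subseteq> ?D'" for n
    using yD' q by (auto simp: Q_def connected_component_refl dest: connected_component_in)
  \<comment> \<open>The small disc links the sets \<open>Q n\<close> with \<open>n \<ge> N\<close>,
    which may be disjoint, into one continuum. It shrinks to \<open>x\<close> as \<open>N\<close>
    grows, so the intersection \<open>L\<close> is connected and lies in \<open>X\<close>.\<close>
  define S where "S N = closure (cball x (r N) \<union> (\<Union>n\<in>{N..}. Q n))" for N
  have S_sub: "cball x (r N) \<union> (\<Union>n\<in>{N..}. Q n) \<subseteq> cball x (e/2)" for N using Q(4) r(2)[of N] by force
  have cS: "compact (S N)" for N
    unfolding S_def using bounded_subset[OF bounded_cball S_sub[of N]]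
    by (intro bounded_closure compact_eq_bounded_closed[THEN iffD2] conjI closed_closure)
  have conS: "connected (S N)" for N
  proof -
    have "connected (\<Union>((\<lambda>n. cball x (r N) \<union> Q n) ` {N..}))"
    proof (rule connected_Union)
      have "x \<in> \<Inter> ((\<lambda>n. cball x (r N) \<union> Q n) ` {N..})" using r(1)[of N] by auto
      then show "\<Inter> ((\<lambda>n. cball x (r N) \<union> Q n) ` {N..}) \<noteq> {}" by blast
      fix T assume "T \<in> (\<lambda>n. cball x (r N) \<union> Q n) ` {N..}"
      then obtain n where n: "n \<ge> N" "T = cball x (r N) \<union> Q n" by auto
      have "y n \<in> cball x (r N) \<inter> Q n" using y(2)[of n] rmono[OF n(1)] Q(2) by auto
      then show "connected T" unfolding n(2) by (intro connected_Un connected_cball Q(1)) blast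
    qed
    moreover have "\<Union>((\<lambda>n. cball x (r N) \<union> Q n) ` {N..}) = cball x (r N) \<union> (\<Union>n\<in>{N..}. Q n)" by auto
    ultimately show ?thesis unfolding S_def by (metis connected_imp_connected_closure)
  qed
  have nest: "S n \<subseteq> S m" if "m \<le> n" for m n
  proof -
    have "cball x (r n) \<subseteq> cball x (r m)" using rmono[OF that] by (rule subset_cball)
    moreover have "(\<Union>k\<in>{n..}. Q k) \<subseteq> (\<Union>k\<in>{m..}. Q k)" using that by force
    ultimately show ?thesis unfolding S_def by (intro closure_mono) blast
  qed
  define L where "L = \<Inter> (range S)"
  have conL: "connected L" unfolding L_def by (rule connected_nest[OF cS conS nest])
  have SX: "S N \<subseteq> X \<union> cball x (r N)" for N
    unfolding S_def using Q(4) clX by (intro closure_minimal) auto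
  have xS: "x \<in> S N" for N
    using closure_subset[of "cball x (r N) \<union> (\<Union>n\<in>{N..}. Q n)"] r(1)[of N] by (auto simp: S_def)
  then have xL: "x \<in> L" by (simp add: L_def)
  have small: "\<exists>N. r N < d" if "d > 0" for d
    using order_tendstoD(2)[OF rlim that] by (auto simp: eventually_sequentially)
  have LX: "L \<subseteq> X"
  proof
    fix z assume z: "z \<in> L"
    show "z \<in> X"
    proof (cases "z = x")
      case False
      then obtain N where "r N < dist x z" using small[of "dist x z"] by auto
      then show ?thesis using z SX[of N] by (auto simp: L_def)
    qed (use xX in simp)
  qed
  \<comment> \<open>A limit of some of the \<open>q n\<close> lies in \<open>L\<close> at distance
    at least \<open>e/2\<close> from \<open>x\<close>; this makes \<open>L\<close>
    nondegenerate.\<close>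
  have "\<forall>n. q n \<in> cball x (e/2)" using Q(3,4) by blast
  then obtain z \<rho> where z: "strict_mono (\<rho> :: nat \<Rightarrow> nat)" "(q \<circ> \<rho>) \<longlonglongrightarrow> z"
    using compact_cball[of x "e/2"] unfolding compact_def by blast
  have "z \<in> S N" for N
  proof (rule Lim_in_closed_set[OF compact_imp_closed[OF cS] _ _ z(2)])
    show "\<forall>\<^sub>F k in sequentially. (q \<circ> \<rho>) k \<in> S N"
    proof (rule eventually_sequentiallyI[of N])
      fix k assume "N \<le> k"
      then have "\<rho> k \<ge> N" using seq_suble[OF z(1), of k] by linarith
      then have "q (\<rho> k) \<in> cball x (r N) \<union> (\<Union>n\<in>{N..}. Q n)" using Q(3) by auto
      then show "(q \<circ> \<rho>) k \<in> S N" unfolding S_def comp_def by (rule subsetD[OF closure_subset])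
    qed
  qed simp
  then have zL: "z \<in> L" by (simp add: L_def)
  have "(\<lambda>k. dist x ((q \<circ> \<rho>) k)) \<longlonglongrightarrow> dist x z" by (intro tendsto_dist tendsto_const z(2))
  then have "e/2 \<le> dist x z" by (rule LIMSEQ_le_const) (use q(2) in auto)
  then have zx: "z \<noteq> x" using e(1) by auto
  have "L \<subseteq> pseudo_fiber X x"
  proof
    fix p assume p: "p \<in> L"
    have "\<not> separated_by \<gamma> x p" if \<gamma>: "good_cut X \<gamma>" for \<gamma>
    proof
      let ?O = "{z. Some z \<notin> \<gamma> ` {0..1}}"
      assume "separated_by \<gamma> x p"
      then obtain U V where UV: "U \<in> components ?O" "V \<in> components ?O" "U \<noteq> V" "x \<in> U" "p \<in> V"
        unfolding separated_by_def by blast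
      have "open ?O" by (rule open_good_cut_complement[OF \<gamma>])
      then have op: "open U" "open V" using UV open_components by blast+
      obtain d where d: "d > 0" "ball x d \<subseteq> U" using op(1) UV(4) openE by blast
      have UVd: "U \<inter> V = {}" using UV components_nonoverlap by blast
      have "\<exists>n\<ge>N. \<exists>g\<in>X \<inter> cball x (e/2). Some g \<in> \<gamma> ` {0..1} \<and> connected_component ?D (y n) g" for N
      proof -
        obtain M where M: "r M < d" using small[OF d(1)] by blast
        define N' where "N' = max M N"
        have "r N' < d" using rmono[of M N'] M by (simp add: N'_def)
        \<comment> \<open>The small disc lies in \<open>U\<close>, so \<open>V\<close> must meet
          some \<open>Q n\<close>; since \<open>y n\<close> is in \<open>U\<close>, this connected
          set meets two components and hence the cut.\<close>
        have "p \<in> S N'" using p by (simp add: L_def)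
        then have "V \<inter> (cball x (r N') \<union> (\<Union>n\<in>{N'..}. Q n)) \<noteq> {}"
          unfolding S_def using UV(5) open_Int_closure_eq_empty[OF op(2)] by blast
        moreover have "cball x (r N') \<subseteq> U" using \<open>r N' < d\<close> d(2) by force
        ultimately obtain n where n: "n \<ge> N'" "V \<inter> Q n \<noteq> {}" using UVd by blast
        have "r n < d" using rmono[OF n(1)] \<open>r N' < d\<close> by linarith
        then have "y n \<in> U" using d(2) y(2)[of n] by force
        then have UQ: "U \<inter> Q n \<noteq> {}" using Q(2) by blast
        have "\<not> Q n \<subseteq> ?O"
        proof
          assume "Q n \<subseteq> ?O"
          then have "Q n \<subseteq> U" "Q n \<subseteq> V"
            using components_maximal[OF UV(1) Q(1) _ UQ] components_maximal[OF UV(2) Q(1) _ n(2)] by blast+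
          then show False using UVd Q(2) by blast
        qed
        then obtain g where g: "g \<in> Q n" "Some g \<in> \<gamma> ` {0..1}" by blast
        have "?D' \<subseteq> ?D" using e(1) by auto
        then have "connected_component ?D (y n) g"
          using g(1) connected_component_of_subset by (fastforce simp: Q_def)
        moreover have "N \<le> n" using n(1) by (simp add: N'_def)
        ultimately show ?thesis using g Q(4)[of n] by blast
      qed
      then obtain c where c: "\<And>N. \<exists>n\<ge>N. connected_component ?D (y n) c"
        using good_cut_hits_one_component_frequently[OF clX \<gamma>, of x "e/2" e y] e(1) by auto
      \<comment> \<open>The component of \<open>c\<close> contains \<open>y n\<close> for
        arbitrarily large \<open>n\<close>; being closed, it contains their limit \<open>x\<close>,
        contrary to the choice of the \<open>y n\<close>.\<close>
      let ?E = "connected_component_set ?D c"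
      have "closed ?E" using clX by (intro closed_connected_component) (simp add: closed_Int)
      moreover have "x \<in> closure ?E"
        unfolding closure_approachable
      proof (intro allI impI)
        fix d :: real assume "d > 0"
        then obtain N where "r N < d" using small by blast
        obtain n where n: "n \<ge> N" "connected_component ?D (y n) c" using c by blast
        have "dist (y n) x < d" using y(2)[of n] rmono[OF n(1)] \<open>r N < d\<close> by (simp add: dist_commute)
        then show "\<exists>w\<in>?E. dist w x < d" using n(2) connected_component_sym by blast
      qed
      ultimately have "connected_component ?D c x" by simp
      moreover obtain n where "connected_component ?D (y n) c" using c by blast
      ultimately show False using y(3) connected_component_sym connected_component_trans by metis
    qed
    then show "p \<in> pseudo_fiber X x" using p LX by (auto simp: pseudo_fiber_def)
  qed
  then have "L \<subseteq> fiber X x" unfolding fiber_def using conL xL by (intro connected_component_maximal)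
  then have "fiber X x \<noteq> {x}" using zL zx by blast
  then show ?thesis using that xX by blast
qed

theorem theorem2p2:
  fixes X :: "complex set"
  assumes "compact X" and "connected X"
    and "finite (components (- X))"
  shows "(locally connected X \<longleftrightarrow> (\<forall>x\<in>X. pseudo_fiber X x = {x}))
       \<and> ((\<forall>x\<in>X. pseudo_fiber X x = {x}) \<longleftrightarrow> (\<forall>x\<in>X. fiber X x = {x}))"
proof -
  have 1: "\<forall>x\<in>X. pseudo_fiber X x = {x}" if "locally connected X"
    using pseudo_fiber_trivial_if_locally_connected[OF assms(1,2) that assms(3)] by blast
  have 2: "\<forall>x\<in>X. fiber X x = {x}" if "\<forall>x\<in>X. pseudo_fiber X x = {x}"
    using that by (simp add: fiber_def connected_component_eq_self)
  have 3: "locally connected X" if "\<forall>x\<in>X. fiber X x = {x}"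
    using fiber_nontrivial_if_not_locally_connected[OF assms(1,2)] that by blast
  from 1 2 3 show ?thesis by blast
qed

end
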